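(* Let $B\in\mathbb{C}^{m\times p}$, $C\in\mathbb{C}^{q\times n}$, $M\in\mathbb{C}^{m\times n}$ and $r\in\mathbb{N}$. Then $$\hat X=B^\dagger(P_{B,L}MP_{C,R})_rC^\dagger$$ is a solution to the problem $$\min\{\|M-BXC\|_F:\ X\in\mathbb{C}^{p\times q},\ \operatorname{rank}X\le r\}.$$ Furthermore, $\hat X$ satisfies $$X=P_{B,R}XP_{C,L}.\qquad(\ast)$$ This solution is the unique solution satisfying $(\ast)$ if and only if one of the following conditions holds: (a) $r\ge\operatorname{rank}(P_{B,L}MP_{C,R})$; (b) $\sigma_r(P_{B,L}MP_{C,R})>\sigma_{r+1}(P_{B,L}MP_{C,R})$.
   Context: $\|\cdot\|_F$ is the Frobenius norm, $A^\dagger$ the Moore--Penrose inverse of a matrix $A$, $P_{A,L}=AA^\dagger$ and $P_{A,R}=A^\dagger A$ (the matrices of the orthogonal projectors onto $\operatorname{ran}A$ and $(\ker A)^\perp$). $\sigma_i(A)$ is the $i$-th largest singular value of $A$ (set to $0$ for $i>\operatorname{rank}A$). If $A=U\Sigma V^*$ is an SVD with nonincreasing singular values and $u_i,v_i$ are the $i$-th columns of $U,V$, then $(A)_r=\sum_{i=1}^r\sigma_iu_iv_i^*$ is a rank-$r$ truncated SVD of $A$ (not unique in general; $(A)_r$ denotes any such choice). *)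

theory Defs
  imports
    "HOL-Computational_Algebra.Polynomial"
    "Jordan_Normal_Form.Schur_Decomposition"
    "Jordan_Normal_Form.DL_Rank"
begin

definition frobenius_norm :: "complex mat \<Rightarrow> real" where
  "frobenius_norm A = sqrt (\<Sum>i<dim_row A. \<Sum>j<dim_col A. (cmod (A $$ (i, j)))\<^sup>2)"

definition is_moore_penrose :: "complex mat \<Rightarrow> complex mat \<Rightarrow> bool" where
  "is_moore_penrose A X \<longleftrightarrow>
     X \<in> carrier_mat (dim_col A) (dim_row A) \<and>
     A * X * A = A \<and> X * A * X = X \<and>
     mat_adjoint (A * X) = A * X \<and> mat_adjoint (X * A) = X * A"

definition pinv :: "complex mat \<Rightarrow> complex mat" where
  "pinv A = (THE X. is_moore_penrose A X)"

definition proj_L :: "complex mat \<Rightarrow> complex mat" where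
  "proj_L A = A * pinv A"

definition proj_R :: "complex mat \<Rightarrow> complex mat" where
  "proj_R A = pinv A * A"

(* The square roots of the eigenvalues of A^* A, with algebraic multiplicity, in
   nonincreasing order. There are dim_col A of them: the list is padded with zeros
   beyond min (dim_row A) (dim_col A). The eigenvalues are real and nonnegative, so
   Re loses nothing. *)
definition singular_values :: "complex mat \<Rightarrow> real list" where
  "singular_values A =
     rev (sorted_list_of_multiset
       (image_mset (\<lambda>z. sqrt (Re z)) (proots (char_poly (mat_adjoint A * A)))))"

(* Indexed from 1; the value at index 0 is a dummy. *)
definition singular_value :: "nat \<Rightarrow> complex mat \<Rightarrow> real" where
  "singular_value i A =
     (if 1 \<le> i \<and> i \<le> length (singular_values A) then singular_values A ! (i - 1) else 0)"

definition unitary_mat :: "complex mat \<Rightarrow> bool" where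
  "unitary_mat U \<longleftrightarrow> square_mat U \<and> inverts_mat (mat_adjoint U) U"

(* A = U \<Sigma> V^*, where \<Sigma> has the shape of A and diagonal entries s 0, s 1, ...
   Values of s from min (dim_row A) (dim_col A) on are irrelevant. *)
definition is_svd :: "complex mat \<Rightarrow> complex mat \<Rightarrow> (nat \<Rightarrow> real) \<Rightarrow> complex mat \<Rightarrow> bool" where
  "is_svd A U s V \<longleftrightarrow>
     U \<in> carrier_mat (dim_row A) (dim_row A) \<and> unitary_mat U \<and>
     V \<in> carrier_mat (dim_col A) (dim_col A) \<and> unitary_mat V \<and>
     (\<forall>i < min (dim_row A) (dim_col A). 0 \<le> s i) \<and>
     (\<forall>i j. i \<le> j \<longrightarrow> j < min (dim_row A) (dim_col A) \<longrightarrow> s j \<le> s i) \<and>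
     A = U * mat (dim_row A) (dim_col A) (\<lambda>(i, j). if i = j then complex_of_real (s i) else 0)
           * mat_adjoint V"

(* T is one of the possible choices of (A)_r, the sum of the first r terms
   s_k u_k v_k^* of some SVD of A. Terms with k \<ge> min (dim_row A) (dim_col A) do not
   exist as columns of both U and V; their singular value is 0 and they are left out. *)
definition is_truncated_svd :: "nat \<Rightarrow> complex mat \<Rightarrow> complex mat \<Rightarrow> bool" where
  "is_truncated_svd r A T \<longleftrightarrow>
     (\<exists>U s V. is_svd A U s V \<and>
        T = mat (dim_row A) (dim_col A)
              (\<lambda>(i, j). \<Sum>k < min r (min (dim_row A) (dim_col A)).
                 complex_of_real (s k) * U $$ (i, k) * cnj (V $$ (j, k))))"

definition is_rank_solution ::
  "complex mat \<Rightarrow> complex mat \<Rightarrow> complex mat \<Rightarrow> nat \<Rightarrow> complex mat \<Rightarrow> bool" where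
  "is_rank_solution B C M r X \<longleftrightarrow>
     is_arg_min (\<lambda>X. frobenius_norm (M - B * X * C))
       (\<lambda>X. X \<in> carrier_mat (dim_col B) (dim_row C) \<and> vec_space.rank (dim_col B) X \<le> r) X"

end

theory Submission
  imports Defs
begin

text \<open>
  Let \<open>P = proj_L B\<close>, \<open>Q = proj_R C\<close> and \<open>A = P M Q\<close>. Every \<open>Y = B X C\<close> satisfies \<open>P Y Q = Y\<close>, so by
  Pythagoras the squared residual is the constant \<open>\<parallel>M - A\<parallel>\<^sup>2\<close> plus \<open>\<parallel>A - Y\<parallel>\<^sup>2\<close>, and
  \<open>X \<mapsto> B X C\<close> is a rank-compatible bijection from the matrices with \<open>(\<ast>)\<close> onto those with
  \<open>P Y Q = Y\<close>. The claim thereby reduces to the Eckart--Young theorem with its uniqueness case.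

  For the latter take \<open>A\<close> diagonal with entries \<open>s\<^sub>j\<close> and let \<open>\<Pi>\<close> be the orthogonal projector onto the
  range of \<open>Y\<close>. Then \<open>\<parallel>A - Y\<parallel>\<^sup>2 = \<parallel>A - \<Pi> A\<parallel>\<^sup>2 + \<parallel>\<Pi> A - Y\<parallel>\<^sup>2\<close>, where the first term is
  \<open>\<Sum>\<^sub>j s\<^sub>j\<^sup>2 (1 - \<Pi>\<^sub>j\<^sub>j)\<close>. The diagonal entries of \<open>\<Pi>\<close> lie in \<open>[0, 1]\<close> and add up to at most
  \<open>r\<close>, so the sum is least when all the weight sits on the first \<open>r\<close> indices, and a gap
  \<open>s\<^sub>r > s\<^sub>r\<^sub>+\<^sub>1\<close> leaves no other choice.
\<close>

section \<open>Matrix algebra and the Frobenius norm\<close>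

text \<open>The ring laws carry equations between dimensions in place of carrier premises, so that
  the simplifier can discharge them once the dimensions are known.\<close>

lemma mult_assoc_dim:
  fixes A B C :: "'a :: semiring_0 mat"
  assumes "dim_col A = dim_row B" "dim_col B = dim_row C"
  shows "A * B * C = A * (B * C)"
  by (rule assoc_mult_mat[of _ "dim_row A" "dim_row B" _ "dim_row C" _ "dim_col C"]) (use assms in auto)

lemma mult_minus_distrib_dim:
  fixes A B C :: "'a :: ring mat"
  assumes "dim_col A = dim_row B" "dim_row B = dim_row C" "dim_col B = dim_col C"
  shows "A * (B - C) = A * B - A * C"
  by (rule mult_minus_distrib_mat[of _ "dim_row A" "dim_row B" _ "dim_col B"]) (use assms in auto)

lemma minus_mult_distrib_dim:
  fixes A B C :: "'a :: ring mat"
  assumes "dim_col A = dim_row C" "dim_row A = dim_row B" "dim_col A = dim_col B"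
  shows "(A - B) * C = A * C - B * C"
  by (rule minus_mult_distrib_mat[of _ "dim_row A" "dim_row C" _ _ "dim_col C"]) (use assms in auto)

lemma mult_add_distrib_dim:
  fixes A B C :: "'a :: semiring_0 mat"
  assumes "dim_col A = dim_row B" "dim_row B = dim_row C" "dim_col B = dim_col C"
  shows "A * (B + C) = A * B + A * C"
  by (rule mult_add_distrib_mat[of _ "dim_row A" "dim_row B" _ "dim_col B"]) (use assms in auto)

lemma add_mult_distrib_dim:
  fixes A B C :: "'a :: semiring_0 mat"
  assumes "dim_col A = dim_row C" "dim_row A = dim_row B" "dim_col A = dim_col B"
  shows "(A + B) * C = A * C + B * C"
  by (rule add_mult_distrib_mat[of _ "dim_row A" "dim_row C" _ _ "dim_col C"]) (use assms in auto)

lemma mult_smult_dim: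
  fixes A B :: "'a :: comm_semiring_0 mat"
  assumes "dim_col A = dim_row B"
  shows "A * (c \<cdot>\<^sub>m B) = c \<cdot>\<^sub>m (A * B)"
  by (rule mult_smult_distrib[of _ "dim_row A" "dim_row B" _ "dim_col B"]) (use assms in auto)

lemma smult_mult_dim:
  fixes A B :: "'a :: comm_semiring_0 mat"
  assumes "dim_col A = dim_row B"
  shows "(c \<cdot>\<^sub>m A) * B = c \<cdot>\<^sub>m (A * B)"
  by (rule mult_smult_assoc_mat[of _ "dim_row A" "dim_row B" _ "dim_col B"]) (use assms in auto)

lemma index_mult_sum:
  assumes "i < dim_row A" "j < dim_col B" "dim_col A = dim_row B"
  shows "(A * B) $$ (i, j) = (\<Sum>k<dim_row B. A $$ (i, k) * B $$ (k, j))"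
  using assms by (simp add: scalar_prod_def atLeast0LessThan)

section \<open>Conjugate transpose\<close>

lemma adjoint_conv_mat:
  "mat_adjoint A = mat (dim_col A) (dim_row A) (\<lambda>(i, j). cnj (A $$ (j, i)))"
  by (rule eq_matI) (auto simp: mat_adjoint_def mat_of_rows_def)

lemma dim_adjoint [simp]:
  fixes A :: "complex mat"
  shows "dim_row (mat_adjoint A) = dim_col A" "dim_col (mat_adjoint A) = dim_row A"
  by (simp_all add: adjoint_conv_mat)

lemma index_adjoint [simp]:
  "i < dim_col A \<Longrightarrow> j < dim_row A \<Longrightarrow> mat_adjoint A $$ (i, j) = cnj (A $$ (j, i))"
  by (simp add: adjoint_conv_mat)

lemma adjoint_adjoint [simp]: "mat_adjoint (mat_adjoint A) = (A :: complex mat)"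
  by (rule eq_matI) auto

lemma adjoint_one [simp]: "mat_adjoint (1\<^sub>m n) = (1\<^sub>m n :: complex mat)"
  by (rule eq_matI) auto

lemma adjoint_mult:
  fixes A B :: "complex mat"
  assumes "dim_col A = dim_row B"
  shows "mat_adjoint (A * B) = mat_adjoint B * mat_adjoint A"
  by (rule eq_matI)
    (use assms in \<open>auto simp: index_mult_sum mult.commute simp del: index_mult_mat(1)\<close>)

lemma adjoint_add:
  fixes A B :: "complex mat"
  assumes "dim_row A = dim_row B" "dim_col A = dim_col B"
  shows "mat_adjoint (A + B) = mat_adjoint A + mat_adjoint B"
  by (rule eq_matI) (use assms in auto)

lemma adjoint_minus:
  fixes A B :: "complex mat"
  assumes "dim_row A = dim_row B" "dim_col A = dim_col B"
  shows "mat_adjoint (A - B) = mat_adjoint A - mat_adjoint B"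
  by (rule eq_matI) (use assms in auto)

lemma adjoint_smult: "mat_adjoint (c \<cdot>\<^sub>m A) = cnj c \<cdot>\<^sub>m mat_adjoint A"
  by (rule eq_matI) auto

section \<open>Trace\<close>

definition trace_mat :: "'a :: comm_monoid_add mat \<Rightarrow> 'a" where
  "trace_mat A = (\<Sum>i<dim_row A. A $$ (i, i))"

lemma trace_mat_comm:
  fixes A B :: "'a :: comm_semiring_0 mat"
  assumes "dim_col A = dim_row B" "dim_col B = dim_row A"
  shows "trace_mat (A * B) = trace_mat (B * A)"
proof -
  have "trace_mat (A * B) = (\<Sum>i<dim_row A. \<Sum>k<dim_row B. A $$ (i, k) * B $$ (k, i))"
    using assms by (simp add: trace_mat_def index_mult_sum del: index_mult_mat(1))
  also have "\<dots> = (\<Sum>k<dim_row B. \<Sum>i<dim_row A. B $$ (k, i) * A $$ (i, k))"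
    by (subst sum.swap) (simp add: mult.commute)
  also have "\<dots> = trace_mat (B * A)"
    using assms by (simp add: trace_mat_def index_mult_sum del: index_mult_mat(1))
  finally show ?thesis .
qed

lemma trace_mat_add:
  assumes "dim_row A = dim_row B" "dim_col A = dim_col B" "dim_row B = dim_col B"
  shows "trace_mat (A + B) = trace_mat A + trace_mat (B :: 'a :: comm_monoid_add mat)"
  using assms by (simp add: trace_mat_def sum.distrib)

lemma trace_mat_minus:
  assumes "dim_row A = dim_row B" "dim_col A = dim_col B" "dim_row B = dim_col B"
  shows "trace_mat (A - B) = trace_mat A - trace_mat (B :: 'a :: ab_group_add mat)"
  using assms by (simp add: trace_mat_def sum_subtractf)

lemma trace_mat_smult:
  assumes "dim_row A = dim_col A"
  shows "trace_mat (c \<cdot>\<^sub>m A) = c * trace_mat (A :: 'a :: semiring_0 mat)"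
  using assms by (simp add: trace_mat_def sum_distrib_left)

lemma trace_mat_adjoint:
  "dim_row A = dim_col A \<Longrightarrow> trace_mat (mat_adjoint A) = cnj (trace_mat A)"
  by (simp add: trace_mat_def)

section \<open>Frobenius norm\<close>

lemma frobenius_norm_sq:
  "(frobenius_norm A)\<^sup>2 = (\<Sum>i<dim_row A. \<Sum>j<dim_col A. (cmod (A $$ (i, j)))\<^sup>2)"
  by (simp add: frobenius_norm_def sum_nonneg)

lemma frobenius_norm_nonneg: "0 \<le> frobenius_norm A"
  by (simp add: frobenius_norm_def sum_nonneg)

text \<open>Turns norm identities into trace computations, where cyclicity and the rules for
  adjoints apply.\<close>

lemma frobenius_norm_sq_trace:
  "complex_of_real ((frobenius_norm A)\<^sup>2) = trace_mat (mat_adjoint A * A)"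
proof -
  have "trace_mat (mat_adjoint A * A) = (\<Sum>j<dim_col A. \<Sum>i<dim_row A. complex_of_real ((cmod (A $$ (i, j)))\<^sup>2))"
    by (simp add: trace_mat_def index_mult_sum complex_norm_square mult.commute
        del: index_mult_mat(1) of_real_power)
  then show ?thesis
    by (subst (asm) sum.swap) (simp add: frobenius_norm_sq)
qed

lemma frobenius_norm_eq_0_iff:
  "frobenius_norm A = 0 \<longleftrightarrow> A = 0\<^sub>m (dim_row A) (dim_col A)"
proof
  assume "frobenius_norm A = 0"
  then have "(\<Sum>i<dim_row A. \<Sum>j<dim_col A. (cmod (A $$ (i, j)))\<^sup>2) = 0"
    using frobenius_norm_sq[of A] by simp
  then have "A $$ (i, j) = 0" if "i < dim_row A" "j < dim_col A" for i j
    using that by (subst (asm) sum_nonneg_eq_0_iff) (auto simp: sum_nonneg_eq_0_iff sum_nonneg)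
  then show "A = 0\<^sub>m (dim_row A) (dim_col A)"
    by (intro eq_matI) auto
next
  assume *: "A = 0\<^sub>m (dim_row A) (dim_col A)"
  have "frobenius_norm (0\<^sub>m (dim_row A) (dim_col A)) = 0"
    by (simp add: frobenius_norm_def)
  with * show "frobenius_norm A = 0" by simp
qed

lemma minus_eq_0_mat:
  fixes A B :: "'a :: ab_group_add mat"
  assumes "A - B = 0\<^sub>m n k" "dim_row A = dim_row B" "dim_col A = dim_col B"
  shows "A = B"
proof (rule eq_matI)
  fix i j assume ij: "i < dim_row B" "j < dim_col B"
  have "dim_row (A - B) = n" "dim_col (A - B) = k"
    using assms(1) by auto
  then have "(A - B) $$ (i, j) = 0"
    using ij by (subst assms(1)) auto
  then show "A $$ (i, j) = B $$ (i, j)"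
    using ij by simp
qed (use assms in auto)

lemma frobenius_norm_minus_eq_0:
  assumes "frobenius_norm (A - B) = 0" "A \<in> carrier_mat m n" "B \<in> carrier_mat m n"
  shows "A = B"
proof (rule minus_eq_0_mat)
  show "A - B = 0\<^sub>m m n"
    using assms by (simp add: frobenius_norm_eq_0_iff)
qed (use assms in auto)

text \<open>The choice of the two projectors makes the two summands orthogonal for the trace form.\<close>

lemma frobenius_norm_pythagoras:
  fixes M P Q Y :: "complex mat"
  assumes M: "M \<in> carrier_mat m n" and P: "P \<in> carrier_mat m m" and Q: "Q \<in> carrier_mat n n"
    and Y: "Y \<in> carrier_mat m n"
    and hP: "mat_adjoint P = P" and hQ: "mat_adjoint Q = Q" and PYQ: "P * Y * Q = Y"
  shows "(frobenius_norm ((M - P * M * Q) + Y))\<^sup>2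
    = (frobenius_norm (M - P * M * Q))\<^sup>2 + (frobenius_norm Y)\<^sup>2"
proof -
  define D where "D = M - P * M * Q"
  note dims = carrier_matD[OF M] carrier_matD[OF P] carrier_matD[OF Q] carrier_matD[OF Y]
  have D: "dim_row D = m" "dim_col D = n" by (simp_all add: D_def dims)
  \<comment> \<open>Cycling \<open>Q\<close> to the right moves both projectors from
    \<open>M\<close> onto \<open>Y\<close>, where \<open>P * Y * Q = Y\<close> absorbs them; hence
    \<open>D\<close> is orthogonal to \<open>Y\<close>.\<close>
  have "trace_mat (mat_adjoint (P * M * Q) * Y) = trace_mat (Q * (mat_adjoint M * P * Y))"
    by (simp add: adjoint_mult dims hP hQ mult_assoc_dim)
  also have "\<dots> = trace_mat (mat_adjoint M * (P * Y * Q))"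
    by (subst trace_mat_comm) (simp_all add: dims mult_assoc_dim)
  finally have 1: "trace_mat (mat_adjoint D * Y) = 0"
    by (simp add: D_def adjoint_minus minus_mult_distrib_dim trace_mat_minus dims PYQ)
  have "trace_mat (mat_adjoint Y * D) = cnj (trace_mat (mat_adjoint D * Y))"
    by (subst trace_mat_adjoint[symmetric]) (simp_all add: D dims adjoint_mult)
  then have 2: "trace_mat (mat_adjoint Y * D) = 0"
    using 1 by simp
  have "complex_of_real ((frobenius_norm (D + Y))\<^sup>2)
      = complex_of_real ((frobenius_norm D)\<^sup>2 + (frobenius_norm Y)\<^sup>2)"
    unfolding of_real_add frobenius_norm_sq_trace
    by (simp add: adjoint_add add_mult_distrib_dim mult_add_distrib_dim trace_mat_add D dims 1 2)
  then show ?thesis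
    unfolding D_def of_real_eq_iff .
qed

text \<open>Gram--Schmidt: the projector is built up by one rank-one term per column of \<open>F\<close>.\<close>

lemma orthogonal_projector_exists:
  fixes F :: "complex mat"
  assumes F: "F \<in> carrier_mat m k"
  shows "\<exists>P W. W \<in> carrier_mat k m \<and> P = F * W \<and> mat_adjoint P = P \<and> P * P = P \<and> P * F = F
    \<and> Re (trace_mat P) \<le> k"
proof -
  \<comment> \<open>\<open>F * e j\<close> is the \<open>j\<close>-th column of \<open>F\<close>,
    kept as a one-column matrix so that the argument stays within matrix algebra.\<close>
  define e where "e j = (mat k 1 (\<lambda>(i, _). if i = j then 1 else 0) :: complex mat)" for j
  have e [simp]: "dim_row (e j) = k" "dim_col (e j) = 1" for j by (simp_all add: e_def)
  note [simp] = carrier_matD[OF F]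
  \<comment> \<open>After \<open>l\<close> steps \<open>P\<close> fixes the first \<open>l\<close>
    columns. The factorization \<open>P = F * W\<close> keeps the range of \<open>P\<close> inside
    that of \<open>F\<close>; its \<open>W\<close> later yields the Moore-Penrose inverse.\<close>
  have "\<exists>P W. W \<in> carrier_mat k m \<and> P = F * W \<and> mat_adjoint P = P \<and> P * P = P
      \<and> (\<forall>j<l. P * (F * e j) = F * e j) \<and> Re (trace_mat P) \<le> l" if "l \<le> k" for l
    using that
  proof (induction l)
    case 0
    show ?case
      by (rule exI[of _ "0\<^sub>m m m"], rule exI[of _ "0\<^sub>m k m"])
        (auto simp: trace_mat_def F right_mult_zero_mat[OF F] intro!: eq_matI)
  next
    case (Suc l)
    then obtain P W where W: "W \<in> carrier_mat k m" and P: "P = F * W" and hP: "mat_adjoint P = P"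
      and PP: "P * P = P" and PF: "\<And>j. j < l \<Longrightarrow> P * (F * e j) = F * e j"
      and tP: "Re (trace_mat P) \<le> l"
      by auto
    note [simp] = carrier_matD[OF W]
    have [simp]: "dim_row P = m" "dim_col P = m" by (simp_all add: P)
    \<comment> \<open>\<open>f\<close> is the part of the new column orthogonal to the range of
      \<open>P\<close>, and \<open>w\<close> holds its coefficients with respect to the columns of
      \<open>F\<close>.\<close>
    define w where "w = e l - W * (F * e l)"
    define f where "f = F * e l - P * (F * e l)"
    have [simp]: "dim_row f = m" "dim_col f = 1" "dim_row w = k" "dim_col w = 1"
      by (simp_all add: f_def w_def)
    have fw: "f = F * w"
      by (simp add: f_def w_def P mult_minus_distrib_dim mult_assoc_dim)
    show ?case
    proof (cases "f = 0\<^sub>m m 1")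
      case True
      then have "P * (F * e l) = F * e l"
        unfolding f_def by (auto dest: minus_eq_0_mat[of "F * e l" "P * (F * e l)"])
      then show ?thesis
        using W P hP PP PF tP by (intro exI[of _ P] exI[of _ W]) (auto simp: less_Suc_eq)
    next
      case False
      \<comment> \<open>With \<open>c = 1 / s\<close> the matrix
        \<open>c \<cdot>\<^sub>m (f * mat_adjoint f)\<close> is the orthogonal projector onto the
        line of \<open>f\<close>. It has trace 1 and annihilates the range of \<open>P\<close>, so
        adding it to \<open>P\<close> gives a projector again.\<close>
      define s where "s = (frobenius_norm f)\<^sup>2"
      define c where "c = complex_of_real (1 / s)"
      have s: "s \<noteq> 0" using False by (simp add: s_def frobenius_norm_eq_0_iff)
      have ff: "mat_adjoint f * f = complex_of_real s \<cdot>\<^sub>m 1\<^sub>m 1"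
        unfolding s_def frobenius_norm_sq_trace by (rule eq_matI) (auto simp: trace_mat_def)
      have Pf: "P * f = 0\<^sub>m m 1"
        unfolding f_def
        by (simp add: mult_minus_distrib_dim mult_assoc_dim[symmetric] PP) (rule eq_matI; simp)
      have fP: "mat_adjoint f * P = 0\<^sub>m 1 m"
        using arg_cong[OF Pf, of mat_adjoint]
        by (simp add: adjoint_mult hP) (auto intro: eq_matI)
      define P' where "P' = P + c \<cdot>\<^sub>m (f * mat_adjoint f)"
      define W' where "W' = W + c \<cdot>\<^sub>m (w * mat_adjoint f)"
      have fff: "f * (mat_adjoint f * (f * X)) = complex_of_real s \<cdot>\<^sub>m (f * X)"
        if "dim_row X = 1" for X
      proof -
        have "mat_adjoint f * (f * X) = complex_of_real s \<cdot>\<^sub>m X"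
          using that by (simp add: mult_assoc_dim[symmetric] ff smult_mult_dim)
        then show ?thesis using that by (simp add: mult_smult_dim)
      qed
      have PfX: "P * (f * X) = 0\<^sub>m m (dim_col X)" if "dim_row X = 1" for X
        using that by (simp add: mult_assoc_dim[symmetric] Pf)
      have fPX: "mat_adjoint f * (P * X) = 0\<^sub>m 1 (dim_col X)" if "dim_row X = m" for X
        using that by (simp add: mult_assoc_dim[symmetric] fP)
      have f0: "f * 0\<^sub>m 1 j = 0\<^sub>m m j" for j
        by (rule right_mult_zero_mat) auto
      have cs: "c * (c * complex_of_real s) = c" "c * complex_of_real s = 1"
        using s by (simp_all add: c_def)
      have P'P': "P' * P' = P'"
        unfolding P'_def
        by (simp add: add_mult_distrib_dim mult_add_distrib_dim smult_mult_dim mult_smult_dim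
            mult_assoc_dim PP PfX fP fff f0)
          (rule eq_matI; simp add: cs mult.assoc[symmetric])
      have hP': "mat_adjoint P' = P'"
        unfolding P'_def by (simp add: adjoint_add adjoint_smult adjoint_mult hP) (simp add: c_def)
      have P': "P' = F * W'"
        unfolding P'_def W'_def
        by (simp add: mult_add_distrib_dim mult_smult_dim mult_assoc_dim[symmetric] P fw)
      have P'F: "P' * (F * e j) = F * e j" if "j < Suc l" for j
      proof (cases "j = l")
        case True
        have "F * e l = f + P * (F * e l)"
          unfolding f_def by (rule eq_matI) auto
        then have "mat_adjoint f * (F * e l) = mat_adjoint f * (f + P * (F * e l))"
          by simp
        also have "\<dots> = complex_of_real s \<cdot>\<^sub>m 1\<^sub>m 1"
          by (simp add: mult_add_distrib_dim fPX ff)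
        finally have "P' * (F * e l) = P * (F * e l) + f"
          unfolding P'_def
          by (simp add: add_mult_distrib_dim smult_mult_dim mult_assoc_dim mult_smult_dim)
            (rule eq_matI; simp add: cs mult.assoc[symmetric])
        also have "\<dots> = F * e l"
          unfolding f_def by (rule eq_matI) auto
        finally show ?thesis using True by simp
      next
        case False
        then have j: "j < l" using that by simp
        have "mat_adjoint f * (F * e j) = mat_adjoint f * (P * (F * e j))"
          using PF[OF j] by simp
        also have "\<dots> = 0\<^sub>m 1 1" by (simp add: fPX)
        finally show ?thesis
          unfolding P'_def
          by (simp add: add_mult_distrib_dim smult_mult_dim mult_assoc_dim PF[OF j] f0)
            (rule eq_matI; simp)
      qed
      have "trace_mat P' = trace_mat P + c * trace_mat (mat_adjoint f * f)"
        unfolding P'_def by (simp add: trace_mat_add trace_mat_smult trace_mat_comm[of f])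
      also have "\<dots> = trace_mat P + 1"
        by (simp add: ff trace_mat_def cs)
      finally have "Re (trace_mat P') \<le> Suc l" using tP by simp
      moreover have "W' \<in> carrier_mat k m" by (auto simp: W'_def)
      ultimately show ?thesis
        using P' hP' P'P' P'F by blast
    qed
  qed
  from this[of k] obtain P W where W: "W \<in> carrier_mat k m" and P: "P = F * W" "mat_adjoint P = P"
    "P * P = P" "Re (trace_mat P) \<le> k" and PF: "\<And>j. j < k \<Longrightarrow> P * (F * e j) = F * e j"
    by auto
  note [simp] = carrier_matD[OF W]
  have [simp]: "dim_row P = m" "dim_col P = m" by (simp_all add: P)
  have col: "(X * e j) $$ (i, 0) = X $$ (i, j)" if "i < dim_row X" "j < k" "dim_col X = k" for X i j
    using that by (simp add: index_mult_sum e_def if_distrib cong: if_cong del: index_mult_mat(1))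
  have "P * F = F"
  proof (rule eq_matI)
    fix i j assume ij: "i < dim_row F" "j < dim_col F"
    then have "(P * F * e j) $$ (i, 0) = (F * e j) $$ (i, 0)"
      using PF[of j] by (simp add: mult_assoc_dim)
    then show "(P * F) $$ (i, j) = F $$ (i, j)"
      using ij by (simp add: col del: index_mult_mat(1))
  qed auto
  with W P show ?thesis by blast
qed

section \<open>Rank and the Moore--Penrose inverse\<close>

text \<open>Independent columns of \<open>Z\<close> that span its column space serve as
  \<open>F\<close>, and their coordinates as \<open>G\<close>; conversely, all columns of
  \<open>F * G\<close> lie in the span of the \<open>k\<close> columns of \<open>F\<close>. Bounds
  on ranks thereby become statements about matrix products.\<close>

lemma rank_le_iff_factorization:
  fixes Z :: "complex mat"
  assumes Z: "Z \<in> carrier_mat m n"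
  shows "vec_space.rank m Z \<le> k \<longleftrightarrow> (\<exists>F G. F \<in> carrier_mat m k \<and> G \<in> carrier_mat k n \<and> Z = F * G)"
proof -
  interpret vec_space "TYPE(complex)" m .
  have cZ: "set (cols Z) \<subseteq> carrier_vec m"
    using cols_dim[of Z] Z by auto
  obtain U where maxU: "maximal U (\<lambda>T. T \<subseteq> set (cols Z) \<and> lin_indpt T)"
    using maximal_exists_superset[of "set (cols Z)" "\<lambda>T. T \<subseteq> set (cols Z) \<and> lin_indpt T" "{}"]
    by (auto simp: finite_lin_indpt2)
  then have UZ: "U \<subseteq> set (cols Z)" and li: "lin_indpt U"
    by (auto simp: maximal_def)
  have U: "U \<subseteq> carrier_vec m" "finite U"
    using UZ cZ finite_subset[OF UZ] by auto
  have rank: "rank Z = card U"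
    by (rule rank_card_indpt[OF Z maxU])
  show ?thesis
  proof
    assume le: "rank Z \<le> k"
    \<comment> \<open>A column outside \<open>U\<close> must depend on \<open>U\<close>, since
      otherwise it would enlarge the maximal independent set.\<close>
    have span: "c \<in> span U" if c: "c \<in> set (cols Z)" for c
    proof (cases "c \<in> U")
      case True
      then show ?thesis using span_mem[OF U(1)] by auto
    next
      case False
      have "lin_dep (U \<union> {c})"
      proof (rule ccontr)
        assume "\<not> lin_dep (U \<union> {c})"
        then have "U \<union> {c} = U"
          using maxU c UZ unfolding maximal_def by blast
        with False show False by auto
      qed
      then show ?thesis
        using lin_dep_iff_in_span[of U c] U(1) li c cZ False by auto
    qed
    have "\<exists>a. c = lincomb a U" if "c \<in> set (cols Z)" for c
      using span[OF that] finite_span[OF U(2)] U(1) by auto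
    then obtain a where a: "\<And>c. c \<in> set (cols Z) \<Longrightarrow> c = lincomb (a c) U"
      by metis
    obtain us where us: "set us = U" "distinct us"
      using finite_distinct_list[OF U(2)] by auto
    have len: "length us \<le> k"
      using le rank us distinct_card by fastforce
    \<comment> \<open>Zero columns of \<open>F\<close> and zero rows of \<open>G\<close> pad the
      inner dimension from \<open>length us\<close> to exactly \<open>k\<close>.\<close>
    define F where "F = mat m k (\<lambda>(i, l). if l < length us then us ! l $ i else 0)"
    define G where "G = mat k n (\<lambda>(l, j). if l < length us then a (col Z j) (us ! l) else 0)"
    have "Z = F * G"
    proof (rule eq_matI)
      fix i j assume "i < dim_row (F * G)" "j < dim_col (F * G)"
      then have ij: "i < m" "j < n" by (auto simp: F_def G_def)
      have c: "col Z j \<in> set (cols Z)"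
        using ij Z by (auto simp: cols_def)
      have "Z $$ (i, j) = col Z j $ i"
        using ij Z by simp
      also have "\<dots> = lincomb (a (col Z j)) U $ i"
        using a[OF c] by simp
      also have "\<dots> = (\<Sum>u\<in>U. a (col Z j) u * u $ i)"
        by (rule lincomb_index[OF ij(1) U(1)])
      also have "\<dots> = (\<Sum>l<length us. a (col Z j) (us ! l) * us ! l $ i)"
        using us(2) unfolding us(1)[symmetric]
        by (intro sum.reindex_bij_betw[symmetric] bij_betw_nth) auto
      also have "\<dots> = (\<Sum>l<k. (if l < length us then us ! l $ i else 0) *
          (if l < length us then a (col Z j) (us ! l) else 0))"
        using len by (intro sum.mono_neutral_cong_left) auto
      also have "\<dots> = (F * G) $$ (i, j)"
        using ij by (subst index_mult_sum) (auto simp: F_def G_def)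
      finally show "Z $$ (i, j) = (F * G) $$ (i, j)" .
    qed (use Z in \<open>auto simp: F_def G_def\<close>)
    then show "\<exists>F G. F \<in> carrier_mat m k \<and> G \<in> carrier_mat k n \<and> Z = F * G"
      by (intro exI[of _ F] exI[of _ G]) (auto simp: F_def G_def)
  next
    assume "\<exists>F G. F \<in> carrier_mat m k \<and> G \<in> carrier_mat k n \<and> Z = F * G"
    then obtain F G where F: "F \<in> carrier_mat m k" and G: "G \<in> carrier_mat k n" and FG: "Z = F * G"
      by auto
    have cF: "set (cols F) \<subseteq> carrier_vec m"
      using cols_dim[of F] F by auto
    \<comment> \<open>The exchange lemma then bounds the independent set \<open>U\<close> by the
      number of columns of \<open>F\<close>.\<close>
    have "U \<subseteq> span (set (cols F))"
    proof
      fix u assume "u \<in> U"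
      then obtain j where j: "j < n" "u = col Z j"
        using UZ Z by (auto simp: cols_def)
      have "u = F *\<^sub>v col G j"
        unfolding j(2) FG by (rule col_mult2[OF F G j(1)])
      then show "u \<in> span (set (cols F))"
        using F G col_space_eq[OF F] j by (auto simp: col_space_def)
    qed
    from replacement[OF U(2) _ _ li this] cF
    have "card U \<le> card (set (cols F))" by auto
    also have "\<dots> \<le> k"
      using card_length[of "cols F"] F by simp
    finally show "rank Z \<le> k"
      using rank by simp
  qed
qed

lemma rank_mult_le_left:
  fixes A B :: "complex mat"
  assumes A: "A \<in> carrier_mat l m" and B: "B \<in> carrier_mat m n" and "vec_space.rank l A \<le> k"
  shows "vec_space.rank l (A * B) \<le> k"
proof -
  obtain F G where FG: "F \<in> carrier_mat l k" "G \<in> carrier_mat k m" "A = F * G"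
    using assms(3) rank_le_iff_factorization[OF A] by auto
  then have "A * B = F * (G * B)" using B by (auto simp: mult_assoc_dim)
  moreover have "G * B \<in> carrier_mat k n" using FG B by auto
  ultimately show ?thesis
    using FG rank_le_iff_factorization[of "A * B" l n k] A B by (metis mult_carrier_mat)
qed

lemma rank_mult_le_right:
  fixes A B :: "complex mat"
  assumes A: "A \<in> carrier_mat l m" and B: "B \<in> carrier_mat m n" and "vec_space.rank m B \<le> k"
  shows "vec_space.rank l (A * B) \<le> k"
proof -
  obtain F G where FG: "F \<in> carrier_mat m k" "G \<in> carrier_mat k n" "B = F * G"
    using assms(3) rank_le_iff_factorization[OF B] by auto
  then have "A * B = (A * F) * G" using A by (auto simp: mult_assoc_dim)
  moreover have "A * F \<in> carrier_mat l k" using FG A by auto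
  ultimately show ?thesis
    using FG rank_le_iff_factorization[of "A * B" l n k] A B by (metis mult_carrier_mat)
qed

text \<open>The projector belongs to the left factor \<open>F\<close> of a factorization of
  \<open>Z\<close>; it fixes \<open>F\<close>, hence \<open>Z\<close>, and the \<open>k\<close>
  columns of \<open>F\<close> bound its trace.\<close>

lemma orthogonal_projector_of_rank:
  assumes Z: "Z \<in> carrier_mat m n" and rank: "vec_space.rank m Z \<le> k"
  shows "\<exists>P. P \<in> carrier_mat m m \<and> mat_adjoint P = P \<and> P * P = P \<and> P * Z = Z
    \<and> Re (trace_mat P) \<le> k"
proof -
  obtain F G where F: "F \<in> carrier_mat m k" and G: "G \<in> carrier_mat k n" and Z': "Z = F * G"
    using rank rank_le_iff_factorization[OF Z] by auto
  obtain P W where W: "W \<in> carrier_mat k m" and P: "P = F * W" "mat_adjoint P = P" "P * P = P"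
    "P * F = F" "Re (trace_mat P) \<le> k"
    using orthogonal_projector_exists[OF F] by auto
  have Pc: "P \<in> carrier_mat m m" using F W P(1) by auto
  have "P * Z = (P * F) * G"
    using Pc F G by (simp add: Z' mult_assoc_dim)
  then show ?thesis using Pc P Z' by auto
qed

text \<open>Taking adjoints in \<open>A * X = (A * Y) * (A * X)\<close> swaps the Hermitian factors,
  and the result collapses to \<open>A * X = A * Y\<close>. Symmetrically
  \<open>X * A = Y * A\<close>, and then \<open>X = X * A * X\<close> can be rewritten into
  \<open>Y\<close>.\<close>

lemma is_moore_penrose_unique:
  assumes X: "is_moore_penrose A X" and Y: "is_moore_penrose A Y"
  shows "X = Y"
proof -
  have eqs: "A * X * A = A" "X * A * X = X" "mat_adjoint (A * X) = A * X" "mat_adjoint (X * A) = X * A"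
    "A * Y * A = A" "Y * A * Y = Y" "mat_adjoint (A * Y) = A * Y" "mat_adjoint (Y * A) = Y * A"
    using X Y by (simp_all add: is_moore_penrose_def)
  have [simp]: "dim_row X = dim_col A" "dim_col X = dim_row A" "dim_row Y = dim_col A" "dim_col Y = dim_row A"
    using X Y by (auto simp: is_moore_penrose_def)
  have "A * X = (A * Y) * (A * X)"
    using arg_cong[OF eqs(5), of "\<lambda>Z. Z * X"] by (simp add: mult_assoc_dim)
  then have "mat_adjoint (A * X) = mat_adjoint (A * X) * mat_adjoint (A * Y)"
    by (subst adjoint_mult[symmetric]) auto
  then have "A * X = (A * X) * (A * Y)"
    by (simp only: eqs)
  also have "\<dots> = A * X * A * Y"
    by (simp add: mult_assoc_dim)
  finally have 1: "A * X = A * Y"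
    by (simp only: eqs)
  have "X * A = (X * A) * (Y * A)"
    using arg_cong[OF eqs(5), of "\<lambda>Z. X * Z"] by (simp add: mult_assoc_dim)
  then have "mat_adjoint (X * A) = mat_adjoint (Y * A) * mat_adjoint (X * A)"
    by (subst adjoint_mult[symmetric]) auto
  then have "X * A = (Y * A) * (X * A)"
    by (simp only: eqs)
  also have "\<dots> = Y * (A * X * A)"
    by (simp add: mult_assoc_dim)
  finally have 2: "X * A = Y * A"
    by (simp only: eqs)
  have "X = X * A * X" by (simp add: eqs)
  also have "\<dots> = Y * (A * X)" by (simp add: 2 mult_assoc_dim)
  also have "\<dots> = Y * A * Y" by (simp add: 1 mult_assoc_dim)
  finally show ?thesis by (simp add: eqs)
qed

text \<open>If \<open>A W\<close> and \<open>V A\<close> are the orthogonal projectors onto the range and the corange of \<open>A\<close>,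
  then the Moore--Penrose inverse is \<open>V A W\<close>.\<close>

lemma is_moore_penrose_exists: "\<exists>X. is_moore_penrose A X"
proof -
  have "\<exists>W. W \<in> carrier_mat (dim_col F) (dim_row F) \<and> mat_adjoint (F * W) = F * W \<and> F * W * F = F"
    for F :: "complex mat"
    using orthogonal_projector_exists[of F "dim_row F" "dim_col F"] by (metis carrier_matI)
  note least_squares_inverse = this[of A] this[of "mat_adjoint A", unfolded dim_adjoint]
  obtain W where W: "W \<in> carrier_mat (dim_col A) (dim_row A)" "mat_adjoint (A * W) = A * W" "A * W * A = A"
    using least_squares_inverse(1) by blast
  obtain V' where V': "V' \<in> carrier_mat (dim_row A) (dim_col A)"
    "mat_adjoint (mat_adjoint A * V') = mat_adjoint A * V'" "mat_adjoint A * V' * mat_adjoint A = mat_adjoint A"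
    using least_squares_inverse(2) by blast
  \<comment> \<open>\<open>V'\<close> comes from the construction for the adjoint of
    \<open>A\<close>; its own adjoint \<open>V\<close> makes \<open>V * A\<close> the projector onto
    the corange.\<close>
  define V where "V = mat_adjoint V'"
  note [simp] = carrier_matD[OF W(1)] carrier_matD[OF V'(1)]
  have V: "dim_row V = dim_col A" "dim_col V = dim_row A" by (simp_all add: V_def)
  note [simp] = V
  have VA: "V * A = mat_adjoint A * V'"
    using V'(2) by (simp add: V_def adjoint_mult)
  have hVA: "mat_adjoint (V * A) = V * A"
    unfolding VA by (fact V'(2))
  have AVA: "A * (V * A) = A"
    using arg_cong[OF V'(3), of mat_adjoint] by (simp add: V_def adjoint_mult mult_assoc_dim)
  have AVAX: "A * (V * (A * X)) = A * X" if "dim_row X = dim_col A" for X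
    using arg_cong[OF AVA, of "\<lambda>Z. Z * X"] that by (simp add: mult_assoc_dim)
  have AWA: "A * (W * A) = A" using W(3) by (simp add: mult_assoc_dim)
  have AWAX: "A * (W * (A * X)) = A * X" if "dim_row X = dim_col A" for X
    using arg_cong[OF AWA, of "\<lambda>Z. Z * X"] that by (simp add: mult_assoc_dim)
  have "is_moore_penrose A (V * A * W)"
    unfolding is_moore_penrose_def
  proof (intro conjI)
    have "A * (V * A * W) = A * W"
      by (simp add: mult_assoc_dim AVAX)
    then show "mat_adjoint (A * (V * A * W)) = A * (V * A * W)"
      using W(2) by simp
    have "V * A * W * A = V * A"
      by (simp add: mult_assoc_dim AWA)
    then show "mat_adjoint (V * A * W * A) = V * A * W * A"
      using hVA by simp
  qed (auto simp: mult_assoc_dim AVAX AWAX AWA)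
  then show ?thesis by blast
qed

lemma is_moore_penrose_pinv: "is_moore_penrose A (pinv A)"
  unfolding pinv_def
  by (rule theI') (use is_moore_penrose_exists is_moore_penrose_unique in blast)

lemma dim_pinv [simp]: "dim_row (pinv A) = dim_col A" "dim_col (pinv A) = dim_row A"
  using is_moore_penrose_pinv[of A] by (auto simp: is_moore_penrose_def)

lemma pinv_carrier: "A \<in> carrier_mat m n \<Longrightarrow> pinv A \<in> carrier_mat n m"
  by auto

lemma dim_proj [simp]:
  "dim_row (proj_L A) = dim_row A" "dim_col (proj_L A) = dim_row A"
  "dim_row (proj_R A) = dim_col A" "dim_col (proj_R A) = dim_col A"
  by (simp_all add: proj_L_def proj_R_def)

text \<open>The Penrose equations in terms of the two projectors. Apart from dimensions and the
  definitions of the projectors, later arguments use nothing else about \<open>pinv\<close>.\<close>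

lemma pinv_simps:
  "proj_L A * A = A" "A * proj_R A = A" "proj_R A * pinv A = pinv A" "pinv A * proj_L A = pinv A"
  "mat_adjoint (proj_L A) = proj_L A" "mat_adjoint (proj_R A) = proj_R A"
  "proj_L A * proj_L A = proj_L A" "proj_R A * proj_R A = proj_R A"
  using is_moore_penrose_pinv[of A]
  by (auto simp: is_moore_penrose_def proj_L_def proj_R_def mult_assoc_dim)

section \<open>Singular value decompositions\<close>

lemma unitary_matD:
  assumes "U \<in> carrier_mat n n" "unitary_mat U"
  shows "mat_adjoint U * U = 1\<^sub>m n" "U * mat_adjoint U = 1\<^sub>m n"
proof -
  show 1: "mat_adjoint U * U = 1\<^sub>m n"
    using assms by (auto simp: unitary_mat_def inverts_mat_def)
  show "U * mat_adjoint U = 1\<^sub>m n"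
    by (rule mat_mult_left_right_inverse[OF _ assms(1) 1]) (use assms in auto)
qed

lemma unitary_cancel:
  assumes "U \<in> carrier_mat n n" "unitary_mat U" "dim_row X = n"
  shows "mat_adjoint U * (U * X) = X" "U * (mat_adjoint U * X) = X"
  using assms unitary_matD[OF assms(1,2)] by (auto simp: mult_assoc_dim[symmetric])

text \<open>In the trace formula \<open>U\<close> cancels directly and \<open>V\<close> after a
  cyclic shift.\<close>

lemma frobenius_norm_unitary:
  assumes U: "U \<in> carrier_mat m m" "unitary_mat U" and V: "V \<in> carrier_mat n n" "unitary_mat V"
    and X: "X \<in> carrier_mat m n"
  shows "frobenius_norm (U * X * mat_adjoint V) = frobenius_norm X"
proof -
  note [simp] = carrier_matD[OF U(1)] carrier_matD[OF V(1)] carrier_matD[OF X]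
  have "complex_of_real ((frobenius_norm (U * X * mat_adjoint V))\<^sup>2)
      = trace_mat (V * (mat_adjoint X * (X * mat_adjoint V)))"
    unfolding frobenius_norm_sq_trace
    by (simp add: adjoint_mult mult_assoc_dim unitary_cancel[OF U])
  also have "\<dots> = trace_mat (mat_adjoint X * X * (mat_adjoint V * V))"
    by (subst trace_mat_comm) (simp_all add: mult_assoc_dim)
  also have "\<dots> = complex_of_real ((frobenius_norm X)\<^sup>2)"
    by (simp add: unitary_matD[OF V] frobenius_norm_sq_trace del: of_real_power)
  finally show ?thesis
    using frobenius_norm_nonneg by (simp only: of_real_eq_iff power2_eq_iff_nonneg)
qed

text \<open>For an SVD \<open>(U, s, V)\<close>, the matrix \<open>U * diag_part m n s K * mat_adjoint V\<close> is the sum of the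
  terms \<open>s\<^sub>k u\<^sub>k v\<^sub>k\<^sup>*\<close> with \<open>k \<in> K\<close>.\<close>

definition diag_part :: "nat \<Rightarrow> nat \<Rightarrow> (nat \<Rightarrow> real) \<Rightarrow> nat set \<Rightarrow> complex mat" where
  "diag_part m n s K = mat m n (\<lambda>(i, j). if i = j \<and> i \<in> K then complex_of_real (s i) else 0)"

lemma dim_diag_part [simp]: "dim_row (diag_part m n s K) = m" "dim_col (diag_part m n s K) = n"
  by (simp_all add: diag_part_def)

lemma diag_part_carrier [simp]: "diag_part m n s K \<in> carrier_mat m n"
  by (simp add: diag_part_def)

lemma index_mult_diag_part:
  assumes "dim_col X = m" "i < dim_row X" "j < n"
  shows "(X * diag_part m n s K) $$ (i, j) = (if j < m \<and> j \<in> K then X $$ (i, j) * complex_of_real (s j) else 0)"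
proof -
  have "(X * diag_part m n s K) $$ (i, j)
      = (\<Sum>a<m. if a = j then (if j \<in> K then X $$ (i, j) * complex_of_real (s j) else 0) else 0)"
    using assms by (subst index_mult_sum) (auto simp: diag_part_def simp del: sum.delta sum.delta' intro!: sum.cong sum.neutral)
  then show ?thesis by simp
qed

text \<open>An index in \<open>L \<inter> K\<close> at or beyond the inner dimension
  \<open>m\<close> could contribute to the right side only, hence the bound on
  \<open>K\<close>.\<close>

lemma diag_part_mult_diag_part:
  assumes "K \<subseteq> {..<m}"
  shows "diag_part l m s L * diag_part m n u K = diag_part l n (\<lambda>i. s i * u i) (L \<inter> K)"
  by (rule eq_matI) (use assms in \<open>auto simp: index_mult_diag_part simp del: index_mult_mat(1),
    auto simp: diag_part_def\<close>)

lemma frobenius_norm_diag_part: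
  assumes "K \<subseteq> {..<min m n}"
  shows "(frobenius_norm (diag_part m n s K))\<^sup>2 = (\<Sum>i\<in>K. (s i)\<^sup>2)"
proof -
  have "(frobenius_norm (diag_part m n s K))\<^sup>2 = (\<Sum>i<m. \<Sum>j<n. if i = j then (if i \<in> K then (s i)\<^sup>2 else 0) else 0)"
    unfolding frobenius_norm_sq by (auto simp: diag_part_def simp del: sum.delta sum.delta' intro!: sum.cong)
  also have "\<dots> = (\<Sum>i<m. if i \<in> K then (s i)\<^sup>2 else 0)"
    using assms by (intro sum.cong) auto
  also have "\<dots> = (\<Sum>i\<in>K. (s i)\<^sup>2)"
    using assms by (intro sum.mono_neutral_cong_right) auto
  finally show ?thesis .
qed

lemma diag_part_diff:
  assumes "K \<subseteq> L"
  shows "diag_part m n s L - diag_part m n s K = diag_part m n s (L - K)"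
  by (rule eq_matI) (use assms in \<open>auto simp: diag_part_def\<close>)

text \<open>With \<open>f\<close> enumerating \<open>K\<close>, the columns of \<open>F\<close> are
  unit vectors for the indices in \<open>K\<close>, and the rows of \<open>G\<close> are the
  matching rows of the diagonal matrix.\<close>

lemma rank_diag_part:
  assumes K: "finite K"
  shows "vec_space.rank m (diag_part m n s K) \<le> card K"
proof -
  obtain f where f: "bij_betw f {..<card K} K"
    using ex_bij_betw_nat_finite[OF K] by (auto simp: atLeast0LessThan)
  define F :: "complex mat" where "F = mat m (card K) (\<lambda>(i, l). if i = f l then 1 else 0)"
  define G where "G = mat (card K) n (\<lambda>(l, j). if j = f l then complex_of_real (s j) else 0)"
  have "diag_part m n s K = F * G"
  proof (rule eq_matI)
    fix i j assume "i < dim_row (F * G)" "j < dim_col (F * G)"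
    then have ij: "i < m" "j < n" by (auto simp: F_def G_def)
    have "(F * G) $$ (i, j) = (\<Sum>l<card K. if i = f l \<and> j = f l then complex_of_real (s j) else 0)"
      using ij by (subst index_mult_sum) (auto simp: F_def G_def intro!: sum.cong)
    also have "\<dots> = (\<Sum>a\<in>K. if i = a \<and> j = a then complex_of_real (s j) else 0)"
      by (rule sum.reindex_bij_betw[OF f])
    also have "\<dots> = (\<Sum>a\<in>K. if a = i then (if i = j then complex_of_real (s i) else 0) else 0)"
      by (intro sum.cong) auto
    also have "\<dots> = diag_part m n s K $$ (i, j)"
      using ij K by (auto simp: diag_part_def)
    finally show "diag_part m n s K $$ (i, j) = (F * G) $$ (i, j)" ..
  qed (auto simp: F_def G_def)
  moreover have "F \<in> carrier_mat m (card K)" "G \<in> carrier_mat (card K) n"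
    by (simp_all add: F_def G_def)
  ultimately show ?thesis
    using rank_le_iff_factorization[OF diag_part_carrier] by blast
qed

lemma truncated_svd_conv_diag_part:
  assumes U: "U \<in> carrier_mat m m" and V: "V \<in> carrier_mat n n" and k: "k \<le> min m n"
  shows "mat m n (\<lambda>(i, j). \<Sum>l<k. complex_of_real (s l) * U $$ (i, l) * cnj (V $$ (j, l)))
    = U * diag_part m n s {..<k} * mat_adjoint V"
proof (rule eq_matI)
  note [simp] = carrier_matD[OF U] carrier_matD[OF V]
  fix i j assume "i < dim_row (U * diag_part m n s {..<k} * mat_adjoint V)"
    "j < dim_col (U * diag_part m n s {..<k} * mat_adjoint V)"
  then have ij: "i < m" "j < n" by auto
  have "(U * diag_part m n s {..<k} * mat_adjoint V) $$ (i, j)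
      = (\<Sum>b<n. (if b < m \<and> b \<in> {..<k} then U $$ (i, b) * complex_of_real (s b) else 0) * cnj (V $$ (j, b)))"
    using ij by (subst index_mult_sum) (simp_all add: index_mult_diag_part del: index_mult_mat(1))
  also have "\<dots> = (\<Sum>l<k. complex_of_real (s l) * U $$ (i, l) * cnj (V $$ (j, l)))"
    using k by (intro sum.mono_neutral_cong_right) auto
  finally show "mat m n (\<lambda>(i, j). \<Sum>l<k. complex_of_real (s l) * U $$ (i, l) * cnj (V $$ (j, l))) $$ (i, j)
    = (U * diag_part m n s {..<k} * mat_adjoint V) $$ (i, j)"
    using ij by simp
qed (use U V in auto)

lemma diag_part_full:
  "mat m n (\<lambda>(i, j). if i = j then complex_of_real (s i) else 0) = diag_part m n s {..<min m n}"
  by (rule eq_matI) (auto simp: diag_part_def)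

lemma is_svd_diag_part:
  assumes "is_svd A U s V" "A \<in> carrier_mat m n"
  shows "A = U * diag_part m n s {..<min m n} * mat_adjoint V"
  using assms unfolding is_svd_def diag_part_full by auto

text \<open>Every part of the SVD is both a left and a right multiple of \<open>A\<close>, so it
  inherits being fixed by \<open>P\<close> or \<open>Q\<close>. This puts the truncated SVD into the
  image of \<open>Z \<mapsto> B * Z * C\<close>.\<close>

lemma svd_part_absorb:
  assumes U: "U \<in> carrier_mat m m" "unitary_mat U" and V: "V \<in> carrier_mat n n" "unitary_mat V"
    and A: "A = U * diag_part m n s {..<min m n} * mat_adjoint V"
    and K: "K \<subseteq> {..<min m n}"
  shows "P * A = A \<Longrightarrow> dim_col P = m \<Longrightarrow>
      P * (U * diag_part m n s K * mat_adjoint V) = U * diag_part m n s K * mat_adjoint V" (is "_ \<Longrightarrow> _ \<Longrightarrow> ?P")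
    and "A * Q = A \<Longrightarrow> dim_row Q = n \<Longrightarrow>
      (U * diag_part m n s K * mat_adjoint V) * Q = U * diag_part m n s K * mat_adjoint V" (is "_ \<Longrightarrow> _ \<Longrightarrow> ?Q")
proof -
  note [simp] = carrier_matD[OF U(1)] carrier_matD[OF V(1)]
  have dA [simp]: "dim_row A = m" "dim_col A = n" by (simp_all add: A)
  \<comment> \<open>Selecting the indices in \<open>K\<close> amounts to multiplying by a diagonal
    matrix of zeros and ones, on either side.\<close>
  have DK: "diag_part m n s K = diag_part m n s {..<min m n} * diag_part n n (\<lambda>_. 1) K"
    "diag_part m n s K = diag_part m m (\<lambda>_. 1) K * diag_part m n s {..<min m n}"
    using K by (subst diag_part_mult_diag_part; auto simp: Int_absorb1 Int_absorb2)+
  have R: "U * diag_part m n s K * mat_adjoint V = A * (V * diag_part n n (\<lambda>_. 1) K * mat_adjoint V)"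
    by (simp add: A mult_assoc_dim unitary_cancel[OF V] DK(1))
  have L: "U * diag_part m n s K * mat_adjoint V = (U * diag_part m m (\<lambda>_. 1) K * mat_adjoint U) * A"
    by (simp add: A mult_assoc_dim unitary_cancel[OF U] DK(2))
  show ?P if "P * A = A" "dim_col P = m"
    unfolding R using that by (simp add: mult_assoc_dim[symmetric])
  show ?Q if "A * Q = A" "dim_row Q = n"
    unfolding L using that by (simp add: mult_assoc_dim)
qed

section \<open>Singular values as roots of a characteristic polynomial\<close>

lemma proots_prod_linear: "proots (\<Prod>a\<leftarrow>xs. [:- a, 1:]) = mset (xs :: 'a :: idom list)"
proof (induction xs)
  case (Cons a xs)
  have "(\<Prod>a\<leftarrow>xs. [:- a, 1:]) \<noteq> 0"
    by (auto simp: prod_list_zero_iff)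
  then have "proots ([:- a, 1:] * (\<Prod>a\<leftarrow>xs. [:- a, 1:])) = {#a#} + mset xs"
    by (subst proots_mult) (simp_all only: Cons.IH proots_linear_factor, auto)
  then show ?case by (simp del: mult_pCons_left)
qed simp

text \<open>\<open>mat_adjoint A * A\<close> is unitarily similar to the diagonal matrix of the
  squares of \<open>s\<close>, so its eigenvalues determine \<open>s\<close>. The shift by one
  arises because \<open>s\<close> counts from 0.\<close>

lemma singular_value_svd:
  assumes svd: "is_svd A U s V" and A: "A \<in> carrier_mat m n"
  shows "singular_value i A = (if 1 \<le> i \<and> i \<le> min m n then s (i - 1) else 0)"
proof -
  define t where "t = min m n"
  \<comment> \<open>\<open>s\<close> is arbitrary from \<open>t\<close> on, whereas the list
    \<open>singular_values A\<close> has \<open>n\<close> entries and is padded with zeros.\<close>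
  define s' where "s' i = (if i < t then s i else 0)" for i
  have U: "U \<in> carrier_mat m m" "unitary_mat U" and V: "V \<in> carrier_mat n n" "unitary_mat V"
    and pos: "\<And>i. i < t \<Longrightarrow> 0 \<le> s i" and mono: "\<And>i j. i \<le> j \<Longrightarrow> j < t \<Longrightarrow> s j \<le> s i"
    using svd A by (auto simp: is_svd_def t_def)
  note [simp] = carrier_matD[OF U(1)] carrier_matD[OF V(1)]
  define L where "L = diag_part n n (\<lambda>i. s i * s i) {..<t}"
  have adj: "mat_adjoint (diag_part m n s {..<t}) = diag_part n m s {..<t}"
    by (rule eq_matI) (auto simp: diag_part_def)
  define S where "S = diag_part m n s {..<t}"
  have A_eq: "A = U * S * mat_adjoint V"
    using is_svd_diag_part[OF svd A] by (simp add: S_def t_def)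
  have SL: "mat_adjoint S * S = L"
    unfolding S_def adj L_def by (subst diag_part_mult_diag_part) (auto simp: t_def)
  have [simp]: "dim_row S = m" "dim_col S = n" by (simp_all add: S_def)
  have "mat_adjoint A * A = V * (mat_adjoint S * S) * mat_adjoint V"
    unfolding A_eq by (simp add: adjoint_mult mult_assoc_dim unitary_cancel[OF U])
  then have VLV: "mat_adjoint A * A = V * L * mat_adjoint V"
    by (simp only: SL)
  have c1: "mat_adjoint A * A \<in> carrier_mat n n"
    by (rule carrier_matI) (simp_all add: carrier_matD[OF A])
  have c2: "L \<in> carrier_mat n n" unfolding L_def by (rule diag_part_carrier)
  have c3: "mat_adjoint V \<in> carrier_mat n n"
    by (rule carrier_matI) simp_all
  have "{mat_adjoint A * A, L, V, mat_adjoint V} \<subseteq> carrier_mat n n"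
    unfolding insert_subset using c1 c2 c3 V(1) by blast
  then have "similar_mat (mat_adjoint A * A) L"
    using unitary_matD(2,1)[OF V] VLV by (rule similar_matI)
  then have "char_poly (mat_adjoint A * A) = char_poly L"
    by (rule char_poly_similar)
  also have "\<dots> = (\<Prod>a\<leftarrow>diag_mat L. [:- a, 1:])"
    by (rule char_poly_upper_triangular[of _ n]) (auto simp: L_def diag_part_def)
  finally have "proots (char_poly (mat_adjoint A * A)) = mset (diag_mat L)"
    by (simp only: proots_prod_linear)
  also have "diag_mat L = map (\<lambda>i. complex_of_real ((s' i)\<^sup>2)) [0..<n]"
    by (auto simp: diag_mat_def L_def diag_part_def s'_def power2_eq_square)
  finally have *: "proots (char_poly (mat_adjoint A * A))
      = mset (map (\<lambda>i. complex_of_real ((s' i)\<^sup>2)) [0..<n])" .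
  have "sqrt (Re (complex_of_real ((s' i)\<^sup>2))) = s' i" for i
    using pos by (simp add: s'_def del: of_real_power)
  then have "image_mset (\<lambda>z. sqrt (Re z)) (proots (char_poly (mat_adjoint A * A)))
      = mset (rev (map s' [0..<n]))"
    unfolding * mset_map[symmetric] map_map o_def mset_rev by (simp only:)
  moreover have "sorted (rev (map s' [0..<n]))"
    unfolding sorted_rev_iff_nth_mono using pos mono by (auto simp: s'_def)
  ultimately have "singular_values A = map s' [0..<n]"
    unfolding singular_values_def by (simp only: sorted_list_of_multiset_mset sorted_sort_id rev_rev_ident)
  then show ?thesis
    by (auto simp: singular_value_def s'_def t_def)
qed

section \<open>The Eckart--Young theorem\<close>

lemma sum_lessThan_split:
  fixes f :: "nat \<Rightarrow> 'a :: comm_monoid_add"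
  assumes "r \<le> t"
  shows "(\<Sum>j<t. f j) = (\<Sum>j<r. f j) + (\<Sum>j\<in>{r..<t}. f j)"
  using assms by (simp add: lessThan_atLeast0 sum.atLeastLessThan_concat)

text \<open>Think of \<open>w\<close> as squared singular values, \<open>d\<close> as the diagonal
  of a projector and \<open>c\<close> as a threshold. The weight of \<open>d\<close> on the tail is
  at most the weight missing from the first \<open>r\<close> indices, and each unit of it saves at
  most \<open>c\<close>. The sum over the head is kept because it decides the equality case.\<close>

lemma weighted_tail_sum:
  fixes w d :: "nat \<Rightarrow> real"
  assumes r: "r \<le> t" and c: "0 \<le> c"
    and small: "\<And>j. r \<le> j \<Longrightarrow> j < t \<Longrightarrow> w j \<le> c"
    and d: "\<And>j. j < t \<Longrightarrow> 0 \<le> d j" and sum: "(\<Sum>j<t. d j) \<le> r"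
  shows "(\<Sum>j\<in>{r..<t}. w j) + (\<Sum>j<r. (w j - c) * (1 - d j)) \<le> (\<Sum>j<t. w j * (1 - d j))"
proof -
  note split = sum_lessThan_split[OF r]
  have "(\<Sum>j\<in>{r..<t}. w j * d j) \<le> c * (\<Sum>j\<in>{r..<t}. d j)"
    unfolding sum_distrib_left by (intro sum_mono mult_right_mono small d) auto
  also have "\<dots> \<le> c * (\<Sum>j<r. 1 - d j)"
    using sum c by (intro mult_left_mono) (auto simp: split sum_subtractf)
  finally show ?thesis
    by (simp add: split algebra_simps sum_subtractf sum.distrib sum_distrib_left)
qed

text \<open>Equality makes the head sum of \<open>weighted_tail_sum\<close> vanish. Its terms are
  nonnegative and \<open>c < w j\<close> there, so \<open>d j = 1\<close> on the head, which
  exhausts the total weight \<open>r\<close>.\<close>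

lemma weighted_tail_sum_equality:
  fixes w d :: "nat \<Rightarrow> real"
  assumes r: "r \<le> t" and c: "0 \<le> c"
    and small: "\<And>j. r \<le> j \<Longrightarrow> j < t \<Longrightarrow> w j \<le> c" and large: "\<And>j. j < r \<Longrightarrow> c < w j"
    and d: "\<And>j. j < t \<Longrightarrow> 0 \<le> d j" "\<And>j. j < t \<Longrightarrow> d j \<le> 1" and sum: "(\<Sum>j<t. d j) \<le> r"
    and eq: "(\<Sum>j<t. w j * (1 - d j)) \<le> (\<Sum>j\<in>{r..<t}. w j)" and j: "j < t"
  shows "d j = (if j < r then 1 else 0)"
proof -
  note split = sum_lessThan_split[OF r]
  have nonneg: "0 \<le> (w j - c) * (1 - d j)" if "j < r" for j
    using that large[of j] d(2)[of j] r by (intro mult_nonneg_nonneg) auto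
  have "(\<Sum>j<r. (w j - c) * (1 - d j)) \<le> 0"
    using weighted_tail_sum[of r t c w d] assms by fastforce
  then have "(\<Sum>j<r. (w j - c) * (1 - d j)) = 0"
    using nonneg by (intro antisym sum_nonneg) auto
  then have "\<forall>j\<in>{..<r}. (w j - c) * (1 - d j) = 0"
    by (subst (asm) sum_nonneg_eq_0_iff) (use nonneg in auto)
  then have one: "d j = 1" if "j < r" for j
    using that large[of j] by auto
  then have "(\<Sum>j<r. d j) = r" by simp
  then have "(\<Sum>j\<in>{r..<t}. d j) \<le> 0" using sum by (simp add: split)
  then have "(\<Sum>j\<in>{r..<t}. d j) = 0"
    using d(1) by (intro antisym sum_nonneg) auto
  then have "\<forall>j\<in>{r..<t}. d j = 0"
    by (subst (asm) sum_nonneg_eq_0_iff) (use d(1) in auto)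
  then show ?thesis using one j by auto
qed

text \<open>The squared norm of the column \<open>P e_j\<close> is the inner product of
  \<open>P e_j\<close> with \<open>e_j\<close>. Hence diagonal entries are nonnegative, and a zero
  entry forces a zero column.\<close>

lemma projector_diag:
  assumes P: "P \<in> carrier_mat m m" "mat_adjoint P = P" "P * P = P" and j: "j < m"
  shows "(\<Sum>i<m. (cmod (P $$ (i, j)))\<^sup>2) = Re (P $$ (j, j))"
proof -
  have herm: "P $$ (j, i) = cnj (P $$ (i, j))" if "i < m" for i
    using arg_cong[OF P(2), of "\<lambda>X. X $$ (j, i)"] that j P(1) by auto
  have "P $$ (j, j) = (P * P) $$ (j, j)" using P(3) by simp
  also have "\<dots> = (\<Sum>i<m. P $$ (j, i) * P $$ (i, j))"
    using P(1) j by (subst index_mult_sum) auto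
  also have "\<dots> = complex_of_real (\<Sum>i<m. (cmod (P $$ (i, j)))\<^sup>2)"
    using herm by (simp add: complex_norm_square mult.commute del: of_real_power)
  finally show ?thesis by simp
qed

lemma projector_complement:
  fixes P :: "complex mat"
  assumes P: "P \<in> carrier_mat m m" "mat_adjoint P = P" "P * P = P"
  shows "1\<^sub>m m - P \<in> carrier_mat m m" "mat_adjoint (1\<^sub>m m - P) = 1\<^sub>m m - P"
    "(1\<^sub>m m - P) * (1\<^sub>m m - P) = 1\<^sub>m m - P"
proof -
  note [simp] = carrier_matD[OF P(1)]
  show "1\<^sub>m m - P \<in> carrier_mat m m"
    by (rule carrier_matI) simp_all
  show "mat_adjoint (1\<^sub>m m - P) = 1\<^sub>m m - P"
    by (simp add: adjoint_minus P(2))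
  have "P - P = 0\<^sub>m m m" "1\<^sub>m m - P - 0\<^sub>m m m = 1\<^sub>m m - P"
    by (rule eq_matI; simp)+
  then show "(1\<^sub>m m - P) * (1\<^sub>m m - P) = 1\<^sub>m m - P"
    by (simp add: mult_minus_distrib_dim minus_mult_distrib_dim P(3))
qed

text \<open>\<open>P\<close> is the orthogonal projector onto the range of \<open>Z\<close>: since \<open>P Z = Z\<close>, the error splits
  into its components outside and inside that range.\<close>

lemma diag_part_error_split:
  fixes Z :: "complex mat" and s :: "nat \<Rightarrow> real"
  assumes Z: "Z \<in> carrier_mat m n" and rank: "vec_space.rank m Z \<le> r" and t: "t = min m n"
  obtains P where "P \<in> carrier_mat m m" "mat_adjoint P = P" "P * P = P"
    "\<And>j. j < m \<Longrightarrow> 0 \<le> Re (P $$ (j, j))" "\<And>j. j < m \<Longrightarrow> Re (P $$ (j, j)) \<le> 1"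
    "(\<Sum>j<t. Re (P $$ (j, j))) \<le> r"
    "(frobenius_norm (diag_part m n s {..<t} - Z))\<^sup>2 =
      (\<Sum>j<t. (s j)\<^sup>2 * (1 - Re (P $$ (j, j)))) + (frobenius_norm (P * diag_part m n s {..<t} - Z))\<^sup>2"
proof -
  obtain P where P: "P \<in> carrier_mat m m" "mat_adjoint P = P" "P * P = P" "P * Z = Z"
    and tr: "Re (trace_mat P) \<le> r"
    using orthogonal_projector_of_rank[OF Z rank] by auto
  note [simp] = carrier_matD[OF P(1)] carrier_matD[OF Z]
  define N where "N = 1\<^sub>m m - P"
  define S where "S = diag_part m n s {..<t}"
  have S [simp]: "dim_row S = m" "dim_col S = n" by (simp_all add: S_def)
  have N: "N \<in> carrier_mat m m" "mat_adjoint N = N" "N * N = N"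
    unfolding N_def by (rule projector_complement[OF P(1-3)])+
  have pos: "0 \<le> Re (P $$ (j, j))" if "j < m" for j
    using projector_diag[OF P(1-3) that, symmetric] by (simp add: sum_nonneg)
  \<comment> \<open>The diagonal of the complementary projector \<open>N\<close> is nonnegative as
    well.\<close>
  have le1: "Re (P $$ (j, j)) \<le> 1" if "j < m" for j
    using projector_diag[OF N that, symmetric] that
    by (simp add: N_def) (smt (verit) sum_nonneg zero_le_power2)
  have "(\<Sum>j<t. Re (P $$ (j, j))) \<le> (\<Sum>j<m. Re (P $$ (j, j)))"
    using t pos by (intro sum_mono2) auto
  also have "\<dots> \<le> r" using tr by (simp add: trace_mat_def)
  finally have sum: "(\<Sum>j<t. Re (P $$ (j, j))) \<le> r" .
  \<comment> \<open>Column \<open>j\<close> of \<open>N * S\<close> is \<open>s j\<close> times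
    column \<open>j\<close> of \<open>N\<close> for \<open>j < t\<close> and zero otherwise;
    \<open>projector_diag\<close> gives the squared norms of the columns of
    \<open>N\<close>.\<close>
  have "(frobenius_norm (N * S))\<^sup>2 = (\<Sum>j<n. \<Sum>i<m. (cmod ((N * S) $$ (i, j)))\<^sup>2)"
    unfolding frobenius_norm_sq using N by (subst sum.swap) simp
  also have "\<dots> = (\<Sum>j<n. if j < t then (s j)\<^sup>2 * (\<Sum>i<m. (cmod (N $$ (i, j)))\<^sup>2) else 0)"
    using N t by (intro sum.cong)
      (auto simp: S_def index_mult_diag_part norm_mult power_mult_distrib sum_distrib_left mult.commute
        simp del: index_mult_mat(1))
  also have "\<dots> = (\<Sum>j<t. (s j)\<^sup>2 * (\<Sum>i<m. (cmod (N $$ (i, j)))\<^sup>2))"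
    using t by (intro sum.mono_neutral_cong_right) auto
  also have "\<dots> = (\<Sum>j<t. (s j)\<^sup>2 * (1 - Re (P $$ (j, j))))"
    using t by (intro sum.cong) (auto simp: projector_diag[OF N], auto simp: N_def)
  finally have NS: "(frobenius_norm (N * S))\<^sup>2 = (\<Sum>j<t. (s j)\<^sup>2 * (1 - Re (P $$ (j, j))))" .
  \<comment> \<open>Pythagoras is applied with the identity as right projector.\<close>
  have 1: "(S - P * S * 1\<^sub>m n) + (P * S - Z) = S - Z"
    by (rule eq_matI) auto
  have 2: "S - P * S * 1\<^sub>m n = N * S"
    by (simp add: N_def minus_mult_distrib_dim)
  have 3: "P * (P * S - Z) * 1\<^sub>m n = P * S - Z"
    using P by (simp add: mult_minus_distrib_dim mult_assoc_dim[symmetric])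
  have "(frobenius_norm ((S - P * S * 1\<^sub>m n) + (P * S - Z)))\<^sup>2
      = (frobenius_norm (S - P * S * 1\<^sub>m n))\<^sup>2 + (frobenius_norm (P * S - Z))\<^sup>2"
    by (rule frobenius_norm_pythagoras[OF _ P(1) _ _ P(2) _ 3]) auto
  then have "(frobenius_norm (S - Z))\<^sup>2 = (frobenius_norm (N * S))\<^sup>2 + (frobenius_norm (P * S - Z))\<^sup>2"
    unfolding 1 unfolding 2 .
  then show ?thesis
    using that P pos le1 sum NS unfolding S_def by auto
qed

text \<open>Moves the approximation problem to the coordinates in which the target is
  diagonal.\<close>

lemma frobenius_norm_svd_shift:
  assumes U: "U \<in> carrier_mat m m" "unitary_mat U" and V: "V \<in> carrier_mat n n" "unitary_mat V"
    and S: "S \<in> carrier_mat m n" and Y: "Y \<in> carrier_mat m n"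
  shows "frobenius_norm (U * S * mat_adjoint V - Y) = frobenius_norm (S - mat_adjoint U * Y * V)"
proof -
  note [simp] = carrier_matD[OF U(1)] carrier_matD[OF V(1)] carrier_matD[OF S] carrier_matD[OF Y]
  have "U * (S - mat_adjoint U * Y * V) * mat_adjoint V = U * S * mat_adjoint V - Y"
    by (simp add: mult_minus_distrib_dim minus_mult_distrib_dim mult_assoc_dim unitary_cancel[OF U] unitary_matD[OF V])
  moreover have "S - mat_adjoint U * Y * V \<in> carrier_mat m n" by auto
  ultimately show ?thesis
    using frobenius_norm_unitary[OF U V] by metis
qed

text \<open>Both parts are read off the error split for \<open>Z\<close>, which is \<open>Y\<close>
  in SVD coordinates: its first summand is at least the tail sum, and under a gap equality
  determines the projector entry by entry. At \<open>r = t\<close> the next singular value is read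
  as 0.\<close>

theorem eckart_young:
  assumes svd: "is_svd A U s V" and A: "A \<in> carrier_mat m n" and t: "t = min m n"
    and Y: "Y \<in> carrier_mat m n" and rank: "vec_space.rank m Y \<le> r"
  shows "(\<Sum>j\<in>{r..<t}. (s j)\<^sup>2) \<le> (frobenius_norm (A - Y))\<^sup>2"
    and "1 \<le> r \<Longrightarrow> r \<le> t \<Longrightarrow> (if r < t then s r else 0) < s (r - 1)
      \<Longrightarrow> (frobenius_norm (A - Y))\<^sup>2 \<le> (\<Sum>j\<in>{r..<t}. (s j)\<^sup>2)
      \<Longrightarrow> Y = U * diag_part m n s {..<r} * mat_adjoint V"
proof -
  have U: "U \<in> carrier_mat m m" "unitary_mat U" and V: "V \<in> carrier_mat n n" "unitary_mat V"
    and pos: "\<And>i. i < t \<Longrightarrow> 0 \<le> s i" and mono: "\<And>i j. i \<le> j \<Longrightarrow> j < t \<Longrightarrow> s j \<le> s i"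
    using svd A by (auto simp: is_svd_def t)
  note [simp] = carrier_matD[OF U(1)] carrier_matD[OF V(1)] carrier_matD[OF Y]
  define Z where "Z = mat_adjoint U * Y * V"
  have Z: "Z \<in> carrier_mat m n" by (auto simp: Z_def)
  note [simp] = carrier_matD[OF Z]
  have YZ: "Y = U * Z * mat_adjoint V"
    by (simp add: Z_def mult_assoc_dim unitary_cancel[OF U] unitary_matD[OF V])
  have "vec_space.rank m (mat_adjoint U * Y) \<le> r"
    by (rule rank_mult_le_right[OF _ Y rank]) auto
  then have "vec_space.rank m Z \<le> r"
    unfolding Z_def by (intro rank_mult_le_left[OF _ V(1)]) auto
  from diag_part_error_split[OF Z this t, of s] obtain P
    where P: "P \<in> carrier_mat m m" "mat_adjoint P = P" "P * P = P"
      and d: "\<And>j. j < m \<Longrightarrow> 0 \<le> Re (P $$ (j, j))" "\<And>j. j < m \<Longrightarrow> Re (P $$ (j, j)) \<le> 1"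
      "(\<Sum>j<t. Re (P $$ (j, j))) \<le> r"
      and norm: "(frobenius_norm (diag_part m n s {..<t} - Z))\<^sup>2 = (\<Sum>j<t. (s j)\<^sup>2 * (1 - Re (P $$ (j, j))))
        + (frobenius_norm (P * diag_part m n s {..<t} - Z))\<^sup>2"
    by blast
  note [simp] = carrier_matD[OF P(1)]
  have AZ: "frobenius_norm (A - Y) = frobenius_norm (diag_part m n s {..<t} - Z)"
    unfolding is_svd_diag_part[OF svd A] Z_def t by (rule frobenius_norm_svd_shift[OF U V diag_part_carrier Y])
  have sq: "(s j)\<^sup>2 \<le> (s i)\<^sup>2" if "i \<le> j" "j < t" for i j
    using mono[OF that] pos[OF that(2)] by (intro power_mono)
  \<comment> \<open>The square of the first discarded singular value, or 0 if none is discarded;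
    under the gap it lies strictly below all retained squares.\<close>
  define c where "c = (if r < t then (s r)\<^sup>2 else 0)"
  have c0: "0 \<le> c" by (simp add: c_def)
  have small: "(s j)\<^sup>2 \<le> c" if "r \<le> j" "j < t" for j
    using sq[OF that] that by (auto simp: c_def)
  have tail: "(\<Sum>j\<in>{r..<t}. (s j)\<^sup>2) \<le> (\<Sum>j<t. (s j)\<^sup>2 * (1 - Re (P $$ (j, j))))" if "r \<le> t"
  proof -
    have "0 \<le> (\<Sum>j<r. ((s j)\<^sup>2 - c) * (1 - Re (P $$ (j, j))))"
      using sq d(2) t that by (intro sum_nonneg mult_nonneg_nonneg) (auto simp: c_def)
    moreover have "(\<Sum>j\<in>{r..<t}. (s j)\<^sup>2) + (\<Sum>j<r. ((s j)\<^sup>2 - c) * (1 - Re (P $$ (j, j))))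
        \<le> (\<Sum>j<t. (s j)\<^sup>2 * (1 - Re (P $$ (j, j))))"
      using d t that by (intro weighted_tail_sum c0 small) auto
    ultimately show ?thesis by linarith
  qed
  show "(\<Sum>j\<in>{r..<t}. (s j)\<^sup>2) \<le> (frobenius_norm (A - Y))\<^sup>2"
  proof (cases "r \<le> t")
    case True
    then show ?thesis
      using tail unfolding AZ norm by (simp add: add_increasing2)
  qed auto
  assume r: "1 \<le> r" "r \<le> t" and gap: "(if r < t then s r else 0) < s (r - 1)"
    and le: "(frobenius_norm (A - Y))\<^sup>2 \<le> (\<Sum>j\<in>{r..<t}. (s j)\<^sup>2)"
  have c: "c < (s j)\<^sup>2" if "j < r" for j
  proof -
    have "c < (s (r - 1))\<^sup>2"
      using gap pos[of r] by (auto simp: c_def intro!: power_strict_mono split: if_splits)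
    also have "\<dots> \<le> (s j)\<^sup>2" using that r by (intro sq) auto
    finally show ?thesis .
  qed
  \<comment> \<open>The first summand of the split already uses up the whole bound
    \<open>le\<close>, leaving nothing for the second.\<close>
  have "(frobenius_norm (P * diag_part m n s {..<t} - Z))\<^sup>2 \<le> 0"
    using tail[OF r(2)] le unfolding AZ norm by linarith
  then have ZP: "Z = P * diag_part m n s {..<t}"
    using P(1) by (intro frobenius_norm_minus_eq_0[OF _ _ Z, symmetric]) auto
  have dj: "Re (P $$ (j, j)) = (if j < r then 1 else 0)" if "j < t" for j
  proof (rule weighted_tail_sum_equality[where w = "\<lambda>j. (s j)\<^sup>2" and c = c])
    show "(\<Sum>j<t. (s j)\<^sup>2 * (1 - Re (P $$ (j, j)))) \<le> (\<Sum>j\<in>{r..<t}. (s j)\<^sup>2)"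
      using le unfolding AZ norm by (smt (verit) zero_le_power2)
  qed (use that d t r c c0 small in auto)
  have col0: "X $$ (i, j) = 0"
    if X: "X \<in> carrier_mat m m" "mat_adjoint X = X" "X * X = X" and "Re (X $$ (j, j)) = 0" "i < m" "j < m"
    for X i j
  proof -
    have "(\<Sum>i<m. (cmod (X $$ (i, j)))\<^sup>2) = 0"
      using projector_diag[OF X] that by simp
    then show ?thesis
      using \<open>i < m\<close> by (subst (asm) sum_nonneg_eq_0_iff) auto
  qed
  define N where "N = 1\<^sub>m m - P"
  have N: "N \<in> carrier_mat m m" "mat_adjoint N = N" "N * N = N"
    unfolding N_def by (rule projector_complement[OF P(1-3)])+
  \<comment> \<open>Diagonal entry 0 kills a column of \<open>P\<close>, and diagonal entry 1 kills
    the same column of \<open>N\<close>; so the first \<open>t\<close> columns of \<open>P\<close>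
    are those of a coordinate projector.\<close>
  have Pij: "P $$ (i, j) = (if i = j \<and> j < r then 1 else 0)" if ij: "i < m" "j < t" for i j
  proof (cases "j < r")
    case True
    then have "N $$ (i, j) = 0"
      using ij t dj[of j] by (intro col0[OF N]) (auto simp: N_def)
    then show ?thesis using ij t True by (auto simp: N_def)
  next
    case False
    then show ?thesis using ij t dj[of j] col0[OF P] by auto
  qed
  have "Z = diag_part m n s {..<r}"
    unfolding ZP
    by (rule eq_matI)
      (use r t in \<open>auto simp: index_mult_diag_part Pij simp del: index_mult_mat(1), auto simp: diag_part_def\<close>)
  then show "Y = U * diag_part m n s {..<r} * mat_adjoint V"
    using YZ by simp
qed

lemma frobenius_norm_svd_part:
  assumes svd: "is_svd A U s V" and A: "A \<in> carrier_mat m n" and K: "K \<subseteq> {..<min m n}"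
  shows "(frobenius_norm (A - U * diag_part m n s K * mat_adjoint V))\<^sup>2
    = (\<Sum>j\<in>{..<min m n} - K. (s j)\<^sup>2)"
proof -
  have U: "U \<in> carrier_mat m m" "unitary_mat U" and V: "V \<in> carrier_mat n n" "unitary_mat V"
    using svd A by (auto simp: is_svd_def)
  note [simp] = carrier_matD[OF U(1)] carrier_matD[OF V(1)]
  have "A - U * diag_part m n s K * mat_adjoint V
      = U * (diag_part m n s {..<min m n} - diag_part m n s K) * mat_adjoint V"
    by (subst is_svd_diag_part[OF svd A]) (simp add: mult_minus_distrib_dim minus_mult_distrib_dim)
  then show ?thesis
    using K by (simp add: diag_part_diff frobenius_norm_unitary[OF U V] frobenius_norm_diag_part)
qed

section \<open>Rank-constrained least squares\<close>

lemma rank_svd_part: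
  assumes U: "U \<in> carrier_mat m m" and V: "V \<in> carrier_mat n n" and K: "finite K" "card K \<le> r"
  shows "vec_space.rank m (U * diag_part m n s K * mat_adjoint V) \<le> r"
proof -
  have "vec_space.rank m (diag_part m n s K) \<le> r"
    using rank_diag_part[OF K(1)] K(2) le_trans by blast
  then have "vec_space.rank m (U * diag_part m n s K) \<le> r"
    by (rule rank_mult_le_right[OF U diag_part_carrier])
  then show ?thesis
    by (rule rank_mult_le_left[rotated 2]) (use U V in auto)
qed

lemma svd_part_inj:
  assumes U: "U \<in> carrier_mat m m" "unitary_mat U" and V: "V \<in> carrier_mat n n" "unitary_mat V"
    and eq: "U * diag_part m n s K * mat_adjoint V = U * diag_part m n s L * mat_adjoint V"
  shows "diag_part m n s K = diag_part m n s L"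
proof -
  note [simp] = carrier_matD[OF U(1)] carrier_matD[OF V(1)]
  have "mat_adjoint U * (U * diag_part m n s J * mat_adjoint V) * V = diag_part m n s J" for J
    by (simp add: mult_assoc_dim unitary_cancel[OF U] unitary_matD[OF V])
  with eq show ?thesis by metis
qed

lemma residual_pythagoras:
  assumes B: "B \<in> carrier_mat m p" and C: "C \<in> carrier_mat q n" and M: "M \<in> carrier_mat m n"
    and X: "X \<in> carrier_mat p q"
  shows "(frobenius_norm (M - B * X * C))\<^sup>2 = (frobenius_norm (M - proj_L B * M * proj_R C))\<^sup>2
    + (frobenius_norm (proj_L B * M * proj_R C - B * X * C))\<^sup>2"
proof -
  define P Q where "P = proj_L B" and "Q = proj_R C"
  note [simp] = carrier_matD[OF B] carrier_matD[OF C] carrier_matD[OF M] carrier_matD[OF X]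
  have P: "P \<in> carrier_mat m m" "mat_adjoint P = P" "P * P = P" "P * B = B"
    and Q: "Q \<in> carrier_mat n n" "mat_adjoint Q = Q" "Q * Q = Q" "C * Q = C"
    by (auto simp: P_def Q_def pinv_simps)
  note [simp] = carrier_matD[OF P(1)] carrier_matD[OF Q(1)]
  have PP: "P * (P * Z) = P * Z" if "dim_row Z = m" for Z
    using P(3) that by (simp add: mult_assoc_dim[symmetric])
  have PB: "P * (B * Z) = B * Z" if "dim_row Z = p" for Z
    using P(4) that by (simp add: mult_assoc_dim[symmetric])
  have 1: "P * (P * M * Q - B * X * C) * Q = P * M * Q - B * X * C"
    by (simp add: mult_minus_distrib_dim minus_mult_distrib_dim mult_assoc_dim PP PB Q)
  have 2: "(M - P * M * Q) + (P * M * Q - B * X * C) = M - B * X * C"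
    by (rule eq_matI) auto
  have "P * M * Q - B * X * C \<in> carrier_mat m n" by (rule carrier_matI) simp_all
  from frobenius_norm_pythagoras[OF M P(1) Q(1) this P(2) Q(2) 1, unfolded 2]
  show ?thesis unfolding P_def Q_def .
qed

text \<open>The equivalence is restricted to \<open>r \<ge> 1\<close> because index 0 of
  \<open>singular_value\<close> is a dummy: for \<open>r = 0\<close> only the zero matrix is
  feasible, so uniqueness always holds, while both conditions fail unless the projected matrix is
  zero.\<close>

theorem corollary3p8:
  fixes B C M T :: "complex mat" and m n p q r :: nat
  assumes B: "B \<in> carrier_mat m p" and C: "C \<in> carrier_mat q n" and M: "M \<in> carrier_mat m n"
    and T: "is_truncated_svd r (proj_L B * M * proj_R C) T"
  defines "X_hat \<equiv> pinv B * T * pinv C"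
  shows "is_rank_solution B C M r X_hat
    \<and> X_hat = proj_R B * X_hat * proj_L C
    \<and> (r \<ge> 1 \<longrightarrow>
        ({X. is_rank_solution B C M r X \<and> X = proj_R B * X * proj_L C} = {X_hat}
         \<longleftrightarrow> r \<ge> vec_space.rank m (proj_L B * M * proj_R C)
           \<or> singular_value r (proj_L B * M * proj_R C)
               > singular_value (r + 1) (proj_L B * M * proj_R C)))"
proof -
  define A where "A = proj_L B * M * proj_R C"
  define t where "t = min m n"
  note [simp] = carrier_matD[OF B] carrier_matD[OF C] carrier_matD[OF M]
  have A: "A \<in> carrier_mat m n" by (rule carrier_matI) (simp_all add: A_def)
  have PA: "proj_L B * A = A" by (simp add: A_def mult_assoc_dim[symmetric] pinv_simps)
  have AQ: "A * proj_R C = A" by (simp add: A_def mult_assoc_dim pinv_simps)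
  obtain U s V where svd: "is_svd A U s V" and
    T_def: "T = mat m n (\<lambda>(i, j). \<Sum>k<min r t. complex_of_real (s k) * U $$ (i, k) * cnj (V $$ (j, k)))"
    using T unfolding is_truncated_svd_def A_def[symmetric] t_def carrier_matD[OF A] by blast
  have U: "U \<in> carrier_mat m m" "unitary_mat U" and V: "V \<in> carrier_mat n n" "unitary_mat V"
    and pos: "\<And>i. i < t \<Longrightarrow> 0 \<le> s i" and mono: "\<And>i j. i \<le> j \<Longrightarrow> j < t \<Longrightarrow> s j \<le> s i"
    using svd A by (auto simp: is_svd_def t_def)
  \<comment> \<open>\<open>T\<close> is the part for the first \<open>min r t\<close> indices;
    another choice of \<open>K\<close> supplies the competitor in the converse.\<close>
  define part where "part K = U * diag_part m n s K * mat_adjoint V" for K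
  have T_part: "T = part {..<min r t}"
    unfolding T_def part_def by (rule truncated_svd_conv_diag_part[OF U(1) V(1)]) (auto simp: t_def)
  \<comment> \<open>The least squared distance from \<open>A\<close> to a matrix of rank at most
    \<open>r\<close>.\<close>
  define E where "E = (\<Sum>j\<in>{r..<t}. (s j)\<^sup>2)"
  \<comment> \<open>The inverse of \<open>Z \<mapsto> B * Z * C\<close> between the matrices fixed
    by the projectors; both directions are verified below.\<close>
  define X where "X Y = pinv B * Y * pinv C" for Y
  define feasible where "feasible Z \<longleftrightarrow> Z \<in> carrier_mat p q \<and> vec_space.rank p Z \<le> r" for Z :: "complex mat"
  have part: "part K \<in> carrier_mat m n" "proj_L B * part K = part K" "part K * proj_R C = part K"
    if K: "K \<subseteq> {..<t}" for K
  proof -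
    note absorb = svd_part_absorb[OF U V is_svd_diag_part[OF svd A] K[unfolded t_def]]
    show "part K \<in> carrier_mat m n"
      unfolding part_def using U(1) V(1) by (intro carrier_matI) simp_all
    show "proj_L B * part K = part K"
      unfolding part_def by (rule absorb(1)[OF PA]) simp
    show "part K * proj_R C = part K"
      unfolding part_def by (rule absorb(2)[OF AQ]) simp
  qed
  have part_rank: "vec_space.rank m (part K) \<le> r" if "K \<subseteq> {..<t}" "card K \<le> r" for K
    unfolding part_def using that finite_subset by (intro rank_svd_part[OF U(1) V(1)]) auto
  have part_norm: "(frobenius_norm (A - part K))\<^sup>2 = (\<Sum>j\<in>{..<t} - K. (s j)\<^sup>2)" if "K \<subseteq> {..<t}" for K
    unfolding part_def t_def by (rule frobenius_norm_svd_part[OF svd A]) (use that t_def in simp)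
  have X: "feasible (X Y)" "B * X Y * C = Y" "X Y = proj_R B * X Y * proj_L C"
    if Y: "Y \<in> carrier_mat m n" "proj_L B * Y = Y" "Y * proj_R C = Y" "vec_space.rank m Y \<le> r" for Y
  proof -
    note [simp] = carrier_matD[OF Y(1)]
    have "vec_space.rank p (pinv B * Y) \<le> r"
      by (rule rank_mult_le_right[OF pinv_carrier[OF B] Y(1) Y(4)])
    then have "vec_space.rank p (X Y) \<le> r"
      unfolding X_def by (rule rank_mult_le_left[OF _ pinv_carrier[OF C], rotated]) (rule carrier_matI; simp)
    moreover have "X Y \<in> carrier_mat p q"
      unfolding X_def by (rule carrier_matI) simp_all
    ultimately show "feasible (X Y)"
      unfolding feasible_def by blast
    have "B * X Y * C = proj_L B * Y * proj_R C"
      by (simp add: X_def proj_L_def proj_R_def mult_assoc_dim)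
    then show "B * X Y * C = Y" using Y by simp
    have "proj_R B * X Y * proj_L C = (proj_R B * pinv B) * Y * (pinv C * proj_L C)"
      by (simp add: X_def mult_assoc_dim)
    then show "X Y = proj_R B * X Y * proj_L C"
      by (simp add: X_def pinv_simps)
  qed
  have X_inv: "Z = X (B * Z * C)" if "Z = proj_R B * Z * proj_L C" "Z \<in> carrier_mat p q" for Z
  proof -
    have "X (B * Z * C) = proj_R B * Z * proj_L C"
      using that(2) by (simp add: X_def proj_L_def proj_R_def mult_assoc_dim)
    then show ?thesis using that(1) by simp
  qed
  have T_norm: "(frobenius_norm (A - T))\<^sup>2 = E"
  proof -
    have "{..<t} - {..<min r t} = {r..<t}" by auto
    then show ?thesis unfolding T_part E_def by (subst part_norm) auto
  qed
  have T_facts: "T \<in> carrier_mat m n" "proj_L B * T = T" "T * proj_R C = T" "vec_space.rank m T \<le> r"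
    unfolding T_part by (intro part part_rank; simp)+
  have X_hat: "X_hat = X T" by (simp add: X_hat_def X_def)
  have rank_image: "B * Z * C \<in> carrier_mat m n" "vec_space.rank m (B * Z * C) \<le> r" if "feasible Z" for Z
  proof -
    have Z: "Z \<in> carrier_mat p q" "vec_space.rank p Z \<le> r" using that by (auto simp: feasible_def)
    show "B * Z * C \<in> carrier_mat m n" using Z B C by auto
    have "vec_space.rank m (B * Z) \<le> r" by (rule rank_mult_le_right[OF B Z])
    then show "vec_space.rank m (B * Z * C) \<le> r"
      by (rule rank_mult_le_left[OF _ C, rotated]) (use B Z in auto)
  qed
  have lower: "E \<le> (frobenius_norm (A - B * Z * C))\<^sup>2" if "feasible Z" for Z
    unfolding E_def using rank_image[OF that] by (intro eckart_young(1)[OF svd A t_def])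
  \<comment> \<open>The residual differs from the distance to \<open>A\<close> by a constant, and
    the lower bound \<open>E\<close> is attained at \<open>X T\<close>; so minimality means reaching
    \<open>E\<close>.\<close>
  have solution: "is_rank_solution B C M r Z \<longleftrightarrow> feasible Z \<and> (frobenius_norm (A - B * Z * C))\<^sup>2 \<le> E" for Z
  proof -
    have le: "frobenius_norm (M - B * Z1 * C) < frobenius_norm (M - B * Z2 * C) \<longleftrightarrow>
        (frobenius_norm (A - B * Z1 * C))\<^sup>2 < (frobenius_norm (A - B * Z2 * C))\<^sup>2"
      if "feasible Z1" "feasible Z2" for Z1 Z2
    proof -
      have "frobenius_norm (M - B * Z1 * C) < frobenius_norm (M - B * Z2 * C) \<longleftrightarrow>
          (frobenius_norm (M - B * Z1 * C))\<^sup>2 < (frobenius_norm (M - B * Z2 * C))\<^sup>2"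
        unfolding not_le[symmetric] by (simp add: frobenius_norm_nonneg power_mono_iff)
      also have "\<dots> \<longleftrightarrow> (frobenius_norm (A - B * Z1 * C))\<^sup>2 < (frobenius_norm (A - B * Z2 * C))\<^sup>2"
        using residual_pythagoras[OF B C M, of Z1, folded A_def]
          residual_pythagoras[OF B C M, of Z2, folded A_def] that
        unfolding feasible_def by linarith
      finally show ?thesis .
    qed
    have *: "is_rank_solution B C M r Z \<longleftrightarrow>
        feasible Z \<and> (\<forall>Z'. feasible Z' \<longrightarrow> \<not> frobenius_norm (M - B * Z' * C) < frobenius_norm (M - B * Z * C))"
      by (auto simp: is_rank_solution_def is_arg_min_def feasible_def)
    have XT: "feasible (X T)" "(frobenius_norm (A - B * X T * C))\<^sup>2 = E"
      using X(1,2)[OF T_facts] T_norm by simp_all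
    show ?thesis
    proof
      assume "is_rank_solution B C M r Z"
      then have "feasible Z" "\<not> frobenius_norm (M - B * X T * C) < frobenius_norm (M - B * Z * C)"
        using XT(1) unfolding * by blast+
      then show "feasible Z \<and> (frobenius_norm (A - B * Z * C))\<^sup>2 \<le> E"
        using le[OF XT(1)] XT(2) by force
    next
      assume Z: "feasible Z \<and> (frobenius_norm (A - B * Z * C))\<^sup>2 \<le> E"
      show "is_rank_solution B C M r Z"
        unfolding * using Z le lower by (meson not_less order_trans)
    qed
  qed
  have 1: "is_rank_solution B C M r X_hat"
    unfolding solution X_hat using X[OF T_facts] T_norm by simp
  have 2: "X_hat = proj_R B * X_hat * proj_L C"
    unfolding X_hat by (rule X(3)[OF T_facts])
  \<comment> \<open>By \<open>X_inv\<close> such a \<open>Z\<close> is determined by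
    \<open>B * Z * C\<close>, so it suffices that all best approximations agree with
    \<open>T\<close>.\<close>
  have unique: "{Z. is_rank_solution B C M r Z \<and> Z = proj_R B * Z * proj_L C} = {X_hat}"
    if image: "\<And>Z. feasible Z \<Longrightarrow> (frobenius_norm (A - B * Z * C))\<^sup>2 \<le> E \<Longrightarrow> B * Z * C = T"
  proof -
    have "Z = X_hat" if "is_rank_solution B C M r Z" "Z = proj_R B * Z * proj_L C" for Z
      using that image[of Z] X_inv[of Z] solution X_hat
      by (auto simp: feasible_def)
    then show ?thesis using 1 2 by blast
  qed
  \<comment> \<open>Translates condition (a): if \<open>A\<close> has rank at most \<open>r\<close>
    it is its own approximation, and \<open>E = 0\<close> forces \<open>A = T\<close>.\<close>
  have E_rank: "vec_space.rank m A \<le> r \<longleftrightarrow> E = 0"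
  proof
    assume "vec_space.rank m A \<le> r"
    then have "E \<le> (frobenius_norm (A - A))\<^sup>2"
      unfolding E_def by (intro eckart_young(1)[OF svd A t_def A])
    then show "E = 0"
      using frobenius_norm_sq[of "A - A"] by (auto simp: E_def intro!: antisym sum_nonneg)
  next
    assume "E = 0"
    then have "A = T"
      using T_norm by (intro frobenius_norm_minus_eq_0[OF _ A T_facts(1)]) simp
    then show "vec_space.rank m A \<le> r" using T_facts(4) by simp
  qed
  have 3: "{Z. is_rank_solution B C M r Z \<and> Z = proj_R B * Z * proj_L C} = {X_hat}
      \<longleftrightarrow> vec_space.rank m A \<le> r \<or> singular_value (r + 1) A < singular_value r A" if r: "1 \<le> r"
  proof
    assume "vec_space.rank m A \<le> r \<or> singular_value (r + 1) A < singular_value r A"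
    then show "{Z. is_rank_solution B C M r Z \<and> Z = proj_R B * Z * proj_L C} = {X_hat}"
    proof
      assume "vec_space.rank m A \<le> r"
      then have "E = 0" by (simp add: E_rank)
      have "Y = A" if Y: "Y \<in> carrier_mat m n" "(frobenius_norm (A - Y))\<^sup>2 \<le> E" for Y
        using frobenius_norm_minus_eq_0[OF _ A Y(1)] Y(2) \<open>E = 0\<close> by simp
      from this[OF rank_image(1)] this[OF T_facts(1)] T_norm show ?thesis
        by (intro unique) simp
    next
      assume gap: "singular_value (r + 1) A < singular_value r A"
      \<comment> \<open>Beyond index \<open>t\<close> all singular values are 0, so a gap can only
        occur for \<open>r \<le> t\<close>.\<close>
      then have rt: "r \<le> t" and "(if r < t then s r else 0) < s (r - 1)"
        using r by (auto simp: singular_value_svd[OF svd A] t_def split: if_splits)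
      then have "Y = T"
        if "Y \<in> carrier_mat m n" "vec_space.rank m Y \<le> r" "(frobenius_norm (A - Y))\<^sup>2 \<le> E" for Y
        using eckart_young(2)[OF svd A t_def that(1,2) r] that(3)
        by (simp add: E_def T_part part_def min_absorb1)
      with rank_image show ?thesis by (intro unique) blast
    qed
  next
    assume uniq: "{Z. is_rank_solution B C M r Z \<and> Z = proj_R B * Z * proj_L C} = {X_hat}"
    show "vec_space.rank m A \<le> r \<or> singular_value (r + 1) A < singular_value r A"
    proof (rule ccontr)
      assume contra: "\<not> (vec_space.rank m A \<le> r \<or> singular_value (r + 1) A < singular_value r A)"
      \<comment> \<open>A nonzero tail makes \<open>s r\<close> positive, and without a gap
        \<open>s (r - 1)\<close> equals it.\<close>
      then have "E \<noteq> 0" by (simp add: E_rank)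
      then obtain j where j: "r \<le> j" "j < t" "s j \<noteq> 0"
        by (auto simp: E_def elim!: sum.not_neutral_contains_not_neutral)
      then have rt: "r < t" and sr: "0 < s r"
        using pos[of j] mono[of r j] by auto
      have eq: "s (r - 1) = s r"
        using contra r rt mono[of "r - 1" r] by (auto simp: singular_value_svd[OF svd A] t_def)
      \<comment> \<open>Trading the term of index \<open>r - 1\<close> for the one of index \<open>r\<close> gives a second minimiser.\<close>
      define K where "K = insert r {..<r - 1}"
      have K: "K \<subseteq> {..<t}" "card K \<le> r"
        using r rt by (auto simp: K_def)
      have "{..<t} - K = insert (r - 1) {Suc r..<t}"
        using r rt by (auto simp: K_def)
      then have "(\<Sum>j\<in>{..<t} - K. (s j)\<^sup>2) = (s r)\<^sup>2 + (\<Sum>j\<in>{Suc r..<t}. (s j)\<^sup>2)"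
        using r eq by simp
      also have "\<dots> = E"
        using rt by (simp add: E_def sum.atLeast_Suc_lessThan)
      finally have "(frobenius_norm (A - part K))\<^sup>2 = E"
        using part_norm[OF K(1)] by simp
      then have "is_rank_solution B C M r (X (part K))"
        unfolding solution using X(1,2)[OF part[OF K(1)] part_rank[OF K]] by simp
      then have "X (part K) = X_hat"
        using uniq X(3)[OF part[OF K(1)] part_rank[OF K]] by blast
      then have "part K = T"
        using X(2)[OF part[OF K(1)] part_rank[OF K]] X(2)[OF T_facts] X_hat by metis
      then have "diag_part m n s K = diag_part m n s {..<r}"
        using svd_part_inj[OF U V] rt by (simp add: part_def T_part min_absorb1)
      \<comment> \<open>This entry separates the two parts: it is \<open>s r\<close> on the left,
        because \<open>r\<close> is in \<open>K\<close>, and 0 on the right.\<close>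
      then have "diag_part m n s K $$ (r, r) = diag_part m n s {..<r} $$ (r, r)" by simp
      then show False
        using rt sr by (simp add: diag_part_def t_def K_def)
    qed
  qed
  show ?thesis
    using 1 2 3 unfolding A_def by blast
qed

end
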